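(* For $n\ge 3$, the polynomial $\widetilde D_n(x)=\sum_{\sigma\in D_n}x^{|\widetilde{\operatorname{Des}}_D\sigma|}$ has only real zeros.
   Context: A signed permutation of $[n]$ is a bijection $\sigma$ of $\{\pm1,\dots,\pm n\}$ with $\sigma(-i)=-\sigma(i)$, in one-line notation $(\sigma_1,\dots,\sigma_n)$. $D_n$ is the set of signed permutations with an even number of negative entries (the Weyl group of type $D_n$). For $\sigma\in D_n$, $\widetilde{\operatorname{Des}}_D\sigma=\{0:\text{if }\sigma_1+\sigma_2<0\}\cup\{i\in[n-1]:\sigma_i>\sigma_{i+1}\}\cup\{n:\text{if }\sigma_{n-1}+\sigma_n>0\}$; this is the set of affine descents of $\sigma$, so $\widetilde D_n(x)$ is the affine Eulerian polynomial of type $D_n$. *)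

theory Defs
  imports
    "HOL-Combinatorics.Permutations"
    "HOL-Computational_Algebra.Polynomial"
    Complex_Main
begin

(* A bijection of {-n,...,-1,1,...,n} is encoded as a function on all integers that is the identity
   off this set, so that distinct functions are distinct signed permutations. *)
definition signed_perms :: "nat \<Rightarrow> (int \<Rightarrow> int) set" where
  "signed_perms n = {\<sigma>. \<sigma> permutes ({- int n..int n} - {0}) \<and>
     (\<forall>i\<in>{- int n..int n} - {0}. \<sigma> (- i) = - \<sigma> i)}"

definition weyl_D :: "nat \<Rightarrow> (int \<Rightarrow> int) set" where
  "weyl_D n = {\<sigma> \<in> signed_perms n. even (card {i \<in> {1..int n}. \<sigma> i < 0})}"

definition affine_Des_D :: "nat \<Rightarrow> (int \<Rightarrow> int) \<Rightarrow> int set" where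
  "affine_Des_D n \<sigma> =
     (if \<sigma> 1 + \<sigma> 2 < 0 then {0} else {}) \<union>
     {i \<in> {1..int n - 1}. \<sigma> i > \<sigma> (i + 1)} \<union>
     (if \<sigma> (int n - 1) + \<sigma> (int n) > 0 then {int n} else {})"

definition affine_Eulerian_D :: "nat \<Rightarrow> real poly" where
  "affine_Eulerian_D n = (\<Sum>\<sigma>\<in>weyl_D n. monom 1 (card (affine_Des_D n \<sigma>)))"

lemma finite_weyl_D: "finite (weyl_D n)"
proof (rule finite_subset)
  show "weyl_D n \<subseteq> {\<sigma>. \<sigma> permutes ({- int n..int n} - {0})}"
    by (auto simp: weyl_D_def signed_perms_def)
qed (simp add: finite_permutations)

lemma finite_affine_Des_D: "finite (affine_Des_D n \<sigma>)"
  by (auto simp: affine_Des_D_def intro: finite_subset[of _ "{1..int n - 1}"])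

end

theory Submission
  imports Defs
begin

text \<open>
  Fix \<open>z\<close> with \<open>Im z > 0\<close>. Refining the sum over \<open>D\<^sub>n\<close> by the last letter and adding letters on the
  right gives sequences of complex numbers with a recursion of the kind used for Eulerian
  polynomials. That recursion preserves the property that \<open>f 0, f 1, \<dots>, z f 0\<close> turn
  counterclockwise (the pointwise form of mutual interlacing), and this property forces the sums to
  be nonzero.

  The right end of type \<open>D\<close> does not fit the recursion. Think of a sequence as the density of the
  last letter, a function on \<open>[-1, 1]\<close> extended to the line by \<open>f (b + 2) = f b / z\<close>; the recursion
  is then integration and commutes with translations. An end of type \<open>D\<close> is twice an end of
  type \<open>C\<close> minus a correction which is a translate by half a period, one level lower. So
  the polynomial becomes a value of another solution of the same recursion, namely
  \<open>aff_seq\<close>. This solution turns counterclockwise from level 6 on; levels 3, 4, 5 are treated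
  by hand.
\<close>

section \<open>Turning of complex numbers and its preservation by the recursion\<close>

text \<open>Nonnegative iff \<open>b\<close> is reached from \<open>a\<close> by a counterclockwise turn of at most \<open>\<pi>\<close>.\<close>

definition crs :: "complex \<Rightarrow> complex \<Rightarrow> real" where
  "crs a b = Im (b * cnj a)"

lemma crs_self [simp]: "crs a a = 0"
  by (simp add: crs_def)

lemma crs_zero [simp]: "crs 0 a = 0" "crs a 0 = 0"
  by (simp_all add: crs_def)

lemma crs_mult_self: "crs a (z * a) = Im z * (cmod a)\<^sup>2"
  unfolding crs_def cmod_power2 by (simp add: algebra_simps power2_eq_square)

lemma crs_mult_mult: "crs (z * a) (z * b) = (cmod z)\<^sup>2 * crs a b"
  unfolding crs_def cmod_power2 by (simp add: algebra_simps power2_eq_square)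

lemma crs_sum_sum: "crs (sum f A) (sum g B) = (\<Sum>i\<in>A. \<Sum>j\<in>B. crs (f i) (g j))"
  by (simp add: crs_def sum_distrib_left sum_distrib_right sum.swap[of _ B A])

text \<open>
  A sequence at level \<open>m\<close> has \<open>2 * m\<close> relevant entries; index \<open>p < m\<close> stands for the last letter
  \<open>m - p\<close>, index \<open>p \<ge> m\<close> for the last letter \<open>m - 1 - p\<close>. The cut \<open>i - 1\<close> for \<open>i > m\<close> reflects that
  appending \<open>1\<close> or \<open>-1\<close> creates a descent after the same letters.
\<close>

definition step :: "nat \<Rightarrow> complex \<Rightarrow> (nat \<Rightarrow> complex) \<Rightarrow> nat \<Rightarrow> complex" where
  "step m z f i = (let c = (if i \<le> m then i else i - 1) in
     z * (\<Sum>j<c. f j) + (\<Sum>j=c..<2*m. f j))"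

text \<open>The zero sequence satisfies all the inequalities; the condition on the total rules out
  this kind of degeneracy and is the source of every strict statement below.\<close>

definition ccw :: "nat \<Rightarrow> complex \<Rightarrow> (nat \<Rightarrow> complex) \<Rightarrow> bool" where
  "ccw N z f \<longleftrightarrow> (\<forall>i j. i \<le> j \<longrightarrow> j < N \<longrightarrow> crs (f i) (f j) \<ge> 0 \<and> crs (f j) (z * f i) \<ge> 0)
     \<and> (\<Sum>j<N. f j) \<noteq> 0"

text \<open>\<open>A\<close>, \<open>B\<close>, \<open>C\<close> are the sums of three consecutive
  blocks, so the two arguments are the entries with the earlier and the later cut. In the bilinear
  expansion the terms pairing \<open>A\<close> with \<open>C\<close> cancel, and \<open>B\<close>
  with itself contributes \<open>crs B (z * B)\<close>.\<close>

lemma crs_cut_forward: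
  assumes "Im z > 0" "crs A B \<ge> 0" "crs B C \<ge> 0" "crs B (z * A) \<ge> 0" "crs C (z * B) \<ge> 0"
  shows "crs (z * A + (B + C)) (z * (A + B) + C) \<ge> 0"
proof -
  have "crs (z * A + (B + C)) (z * (A + B) + C) =
    (cmod z)\<^sup>2 * crs A B + crs B (z * A) + Im z * (cmod B)\<^sup>2 + crs B C + crs C (z * B)"
    unfolding crs_def cmod_power2 by (simp add: algebra_simps power2_eq_square)
  with assms show ?thesis by simp
qed

text \<open>The companion for the passage from the later entry to \<open>z\<close> times the earlier
  one. Here the terms pairing \<open>A\<close> with \<open>C\<close> do not cancel but complete the
  square \<open>(cmod (z * A + C))\<^sup>2\<close>.\<close>

lemma crs_cut_wrap:
  assumes "Im z > 0" "crs A B \<ge> 0" "crs B C \<ge> 0" "crs B (z * A) \<ge> 0" "crs C (z * B) \<ge> 0"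
  shows "crs (z * (A + B) + C) (z * (z * A + (B + C))) \<ge> 0"
proof -
  have "crs (z * (A + B) + C) (z * (z * A + (B + C))) =
    Im z * (cmod (z * A + C))\<^sup>2 + (cmod z)\<^sup>2 * (crs A B + crs B (z * A) + crs B C) + crs C (z * B)"
    unfolding crs_def cmod_power2 by (simp add: algebra_simps power2_eq_square)
  with assms show ?thesis by simp
qed

lemma ccw_blocks:
  assumes "ccw N z f" "\<And>i j. i \<in> I \<Longrightarrow> j \<in> J \<Longrightarrow> i \<le> j \<and> j < N"
  shows "crs (sum f I) (sum f J) \<ge> 0" "crs (sum f J) (z * sum f I) \<ge> 0"
  using assms unfolding sum_distrib_left crs_sum_sum ccw_def by (auto intro!: sum_nonneg)

lemma step_cut:
  fixes m i :: nat
  defines "c \<equiv> (if i \<le> m then i else i - 1)"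
  assumes "i \<le> 2 * m + 1"
  shows "c \<le> 2 * m" "step m z f i = z * (\<Sum>j<c. f j) + (\<Sum>j=c..<2*m. f j)"
  using assms by (auto simp: step_def c_def Let_def)

lemma lessThan_split:
  fixes f :: "nat \<Rightarrow> 'a :: comm_monoid_add"
  assumes "c \<le> N"
  shows "sum f {..<c} + sum f {c..<N} = sum f {..<N}"
  using sum.atLeastLessThan_concat[of 0 c N f] assms by (simp add: atLeast0LessThan)

text \<open>Each new entry is given by one cut of the old sequence, so two new entries divide it
  into three blocks, and block sums inherit the turning by bilinearity.\<close>

lemma ccw_step:
  assumes z: "Im z > 0" and f: "ccw (2 * m) z f"
  shows "ccw (2 * m + 2) z (step m z f)"
proof -
  let ?g = "step m z f"
  have pair: "crs (?g i) (?g j) \<ge> 0 \<and> crs (?g j) (z * ?g i) \<ge> 0" if "i \<le> j" "j < 2 * m + 2" for i j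
  proof -
    define c where "c = (if i \<le> m then i else i - 1)"
    define d where "d = (if j \<le> m then j else j - 1)"
    have cd: "c \<le> d" "d \<le> 2 * m"
      using that by (auto simp: c_def d_def)
    let ?A = "\<Sum>j<c. f j" and ?B = "\<Sum>j=c..<d. f j" and ?C = "\<Sum>j=d..<2*m. f j"
    have gi: "?g i = z * ?A + (?B + ?C)"
      using step_cut(2)[of i m z f] that cd by (simp add: c_def[symmetric] sum.atLeastLessThan_concat)
    have gj: "?g j = z * (?A + ?B) + ?C"
      using step_cut(2)[of j m z f] that cd by (simp add: d_def[symmetric] lessThan_split)
    have "crs ?A ?B \<ge> 0" "crs ?B (z * ?A) \<ge> 0" "crs ?B ?C \<ge> 0" "crs ?C (z * ?B) \<ge> 0"
      using cd by (auto intro!: ccw_blocks[OF f])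
    then show ?thesis
      unfolding gi gj using crs_cut_forward[OF z] crs_cut_wrap[OF z] by blast
  qed
  have first: "?g 0 = (\<Sum>j<2*m. f j)"
    by (simp add: step_def atLeast0LessThan)
  have last: "?g (2 * m + 1) = z * ?g 0"
    unfolding first by (simp add: step_def)
  \<comment> \<open>The cut before everything gives the old total, the cut after everything gives
    \<open>z\<close> times it. This one pair is strictly positive, so the new total cannot
    vanish.\<close>
  have "0 < crs (?g 0) (?g (2 * m + 1))"
    unfolding last crs_mult_self using z f by (simp add: first ccw_def)
  also have "\<dots> \<le> (\<Sum>j<2*m+2. crs (?g 0) (?g j))"
    by (rule member_le_sum) (use pair in auto)
  also have "\<dots> = crs (?g 0) (\<Sum>j<2*m+2. ?g j)"
    using crs_sum_sum[of "\<lambda>_. ?g 0" "{0::nat}" ?g "{..<2*m+2}"] by simp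
  finally have "(\<Sum>j<2*m+2. ?g j) \<noteq> 0"
    by auto
  with pair show ?thesis
    by (simp add: ccw_def)
qed

text \<open>If \<open>z * A + C = 0\<close>, then \<open>C\<close> is \<open>A\<close> turned by
  \<open>arg z + \<pi>\<close>, which contradicts the turning from \<open>A\<close> to
  \<open>C\<close> unless both vanish, and then the total is zero.\<close>

lemma ccw_step_nonzero:
  assumes z: "Im z > 0" and f: "ccw (2 * m) z f" and i: "i \<le> 2 * m + 1"
  shows "step m z f i \<noteq> 0"
proof
  assume "step m z f i = 0"
  define c where "c = (if i \<le> m then i else i - 1)"
  let ?A = "\<Sum>j<c. f j" and ?C = "\<Sum>j=c..<2*m. f j"
  have c: "c \<le> 2 * m" and g: "step m z f i = z * ?A + ?C"
    using step_cut[OF i] by (simp_all add: c_def)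
  have C: "?C = - (z * ?A)"
    using g \<open>step m z f i = 0\<close> by (simp add: add_eq_0_iff)
  have "crs ?A ?C \<ge> 0"
    using c by (auto intro!: ccw_blocks[OF f])
  moreover have "crs ?A ?C = - (Im z * (cmod ?A)\<^sup>2)"
    unfolding C crs_mult_self[symmetric] by (simp add: crs_def)
  ultimately have "Im z * (cmod ?A)\<^sup>2 \<le> 0"
    by linarith
  with z have "?A = 0"
    by (simp add: mult_le_0_iff)
  with C lessThan_split[OF c, of f] have "(\<Sum>j<2*m. f j) = 0"
    by simp
  with f show False
    by (simp add: ccw_def)
qed

section \<open>Translation by half a period\<close>

text \<open>
  Translation of the density by half a period, with the Bernstein coefficients raised from degree
  \<open>m - 1\<close> to degree \<open>m\<close> on each half.
\<close>

definition shift :: "nat \<Rightarrow> complex \<Rightarrow> (nat \<Rightarrow> complex) \<Rightarrow> nat \<Rightarrow> complex" where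
  "shift m z f q = (if q \<le> m then of_nat (m - q) * f (m + q) + of_nat q * f (m + q - 1)
     else z * (of_nat (2 * m + 1 - q) * f (q - m - 1) + of_nat (q - m - 1) * f (q - m - 2)))"

text \<open>Degree raising passes through prefix sums: on the left each \<open>f q\<close> with
  \<open>q < c - 1\<close> collects \<open>(m - q) + (q + 1) = m + 1\<close>, while
  \<open>f (c - 1)\<close> collects only \<open>m + 1 - c\<close>. The truncated
  \<open>q - 1\<close> at \<open>q = 0\<close> carries the factor 0.\<close>

lemma sum_raise:
  fixes f :: "nat \<Rightarrow> complex"
  shows "c \<le> m + 1 \<Longrightarrow> (\<Sum>q<c. of_nat (m - q) * f q + of_nat q * f (q - 1)) =
    of_nat (m + 1 - c) * (\<Sum>q<c. f q) + of_nat c * (\<Sum>q<c - 1. f q)"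
proof (induction c)
  case (Suc c)
  then have c: "c \<le> m" by simp
  show ?case
  proof (cases c)
    case (Suc d)
    then show ?thesis
      using Suc.IH c by (simp add: of_nat_diff algebra_simps)
  qed (simp add: algebra_simps)
qed simp

text \<open>In this form an entry depends on the cut only through a prefix sum, the discrete
  antiderivative, so that \<open>sum_raise\<close> applies.\<close>

lemma step_eq:
  assumes "i \<le> 2 * m + 1"
  shows "step m z f i = (\<Sum>j<2*m. f j) - (1 - z) * (\<Sum>j<(if i \<le> m then i else i - 1). f j)"
  using step_cut(2)[OF assms, of z f] lessThan_split[OF step_cut(1)[OF assms], of f]
  by (simp add: algebra_simps)

lemma sum_lessThan_add:
  fixes f :: "nat \<Rightarrow> 'a :: comm_monoid_add"
  shows "(\<Sum>q<m + r. f q) = (\<Sum>q<m. f q) + (\<Sum>q<r. f (m + q))"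
  by (induction r) (simp_all add: add.assoc)

lemma sum_shift_low:
  assumes "c \<le> m + 1"
  shows "(\<Sum>q<c. shift m z f q) =
    of_nat (m + 1 - c) * (\<Sum>q<c. f (m + q)) + of_nat c * (\<Sum>q<c - 1. f (m + q))"
proof -
  have "(\<Sum>q<c. shift m z f q) = (\<Sum>q<c. of_nat (m - q) * f (m + q) + of_nat q * f (m + (q - 1)))"
  proof (intro sum.cong refl)
    show "shift m z f q = of_nat (m - q) * f (m + q) + of_nat q * f (m + (q - 1))" if "q \<in> {..<c}" for q
      using that assms by (cases q) (auto simp: shift_def)
  qed
  then show ?thesis
    using sum_raise[OF assms, of "\<lambda>q. f (m + q)"] by simp
qed

lemma sum_shift_high:
  assumes "r \<le> m + 1"
  shows "(\<Sum>q<m + 1 + r. shift m z f q) = of_nat (m + 1) * (\<Sum>q<m. f (m + q)) +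
    z * (of_nat (m + 1 - r) * (\<Sum>q<r. f q) + of_nat r * (\<Sum>q<r - 1. f q))"
proof -
  have "(\<Sum>q<r. shift m z f (m + 1 + q)) = z * (\<Sum>q<r. of_nat (m - q) * f q + of_nat q * f (q - 1))"
    unfolding sum_distrib_left
    using assms by (intro sum.cong) (auto simp: shift_def)
  then show ?thesis
    using sum_shift_low[of "m + 1" m z f] sum_raise[OF assms, of f]
      sum_lessThan_add[of "shift m z f" "m + 1" r] by simp
qed

lemma sum_shift_total:
  "(\<Sum>q<2 * m + 2. shift m z f q) = of_nat (m + 1) * ((\<Sum>q<m. f (m + q)) + z * (\<Sum>q<m. f q))"
proof -
  have "2 * m + 2 = m + 1 + (m + 1)" by simp
  then show ?thesis
    by (simp only: sum_shift_high[OF order_refl]) (simp add: algebra_simps)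
qed

text \<open>Integration commutes with translation. Both sides are combinations of prefix sums of the
  two halves of \<open>f\<close>; degree raising passes through these by \<open>sum_raise\<close>,
  and \<open>sum_shift_total\<close> fixes the constant of integration.\<close>

lemma step_shift:
  assumes "i < 2 * m + 4"
  shows "step (m + 1) z (shift m z f) i = shift (m + 1) z (step m z f) i"
proof -
  define S where "S = (\<Sum>q<m. f (m + q))"
  define F where "F = (\<Sum>q<m. f q)"
  have tot: "(\<Sum>q<2*m. f q) = F + S"
    using sum_lessThan_add[of f m m] by (simp add: mult_2 S_def F_def)
  have low: "step (m + 1) z g i = (\<Sum>j<2*m+2. g j) - (1 - z) * (\<Sum>j<i. g j)" if "i \<le> m + 1" for g i
    using step_eq[of i "m + 1" z g] that by simp
  show ?thesis
  proof (cases "i \<le> m + 1")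
    case True
    have b: "step m z f (m + 1 + i) = F + S - (1 - z) * (F + (\<Sum>q<i. f (m + q)))" if "i \<le> m" for i
      using step_eq[of "m + 1 + i" m z f] that tot sum_lessThan_add[of f m i] by (simp add: F_def)
    \<comment> \<open>At \<open>i = m + 1\<close> the entry is outside the range of
      \<open>b\<close>, but its coefficient is 0; the same happens at \<open>i = 0\<close> in the
      next equation.\<close>
    have e1: "of_nat (m + 1 - i) * step m z f (m + 1 + i) =
       of_nat (m + 1 - i) * (F + S - (1 - z) * (F + (\<Sum>q<i. f (m + q))))"
      using b[of i] True by (cases "i = m + 1") auto
    have e2: "of_nat i * step m z f (m + i) =
       of_nat i * (F + S - (1 - z) * (F + (\<Sum>q<i - 1. f (m + q))))"
      using b[of "i - 1"] True by (cases i) auto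
    have "shift (m + 1) z (step m z f) i =
      of_nat (m + 1 - i) * step m z f (m + 1 + i) + of_nat i * step m z f (m + i)"
      using True by (simp add: shift_def)
    also have "\<dots> = of_nat (m + 1) * (F + S - (1 - z) * F) -
       (1 - z) * (of_nat (m + 1 - i) * (\<Sum>q<i. f (m + q)) + of_nat i * (\<Sum>q<i - 1. f (m + q)))"
      unfolding e1 e2 using True by (simp add: of_nat_diff algebra_simps)
    finally show ?thesis
      unfolding low[OF True] sum_shift_low[OF True] sum_shift_total S_def[symmetric] F_def[symmetric]
      by (simp add: algebra_simps)
  next
    case False
    define r where "r = i - (m + 2)"
    have i: "i = m + 2 + r" and r: "r \<le> m + 1"
      using False assms by (auto simp: r_def)
    have b: "step m z f q = F + S - (1 - z) * (\<Sum>j<q. f j)" if "q \<le> m" for q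
      using step_eq[of q m z f] that tot by simp
    have e1: "of_nat (m + 1 - r) * step m z f r = of_nat (m + 1 - r) * (F + S - (1 - z) * (\<Sum>q<r. f q))"
      using b[of r] r by (cases "r = m + 1") auto
    have e2: "of_nat r * step m z f (r - 1) = of_nat r * (F + S - (1 - z) * (\<Sum>q<r - 1. f q))"
      using b[of "r - 1"] r by (cases r) auto
    have "shift (m + 1) z (step m z f) i =
      z * (of_nat (m + 1 - r) * step m z f r + of_nat r * step m z f (r - 1))"
      by (simp add: shift_def i)
    also have "\<dots> = z * (of_nat (m + 1) * (F + S) -
       (1 - z) * (of_nat (m + 1 - r) * (\<Sum>q<r. f q) + of_nat r * (\<Sum>q<r - 1. f q)))"
      unfolding e1 e2 using r by (simp add: of_nat_diff algebra_simps)
    finally have R: "shift (m + 1) z (step m z f) i = \<dots>" .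
    have "step (m + 1) z (shift m z f) i =
       (\<Sum>j<2*m+2. shift m z f j) - (1 - z) * (\<Sum>j<m+1+r. shift m z f j)"
      using step_eq[of i "m + 1" z "shift m z f"] r by (simp add: i)
    then show ?thesis
      unfolding R sum_shift_high[OF r] sum_shift_total S_def[symmetric] F_def[symmetric]
      by (simp add: algebra_simps)
  qed
qed

section \<open>Signed permutations by their last letter\<close>

abbreviation pm :: "nat \<Rightarrow> int set" where
  "pm n \<equiv> {- int n..int n} - {0}"

lemma signed_permsI:
  assumes "\<And>i. i \<notin> pm n \<Longrightarrow> \<sigma> i = i" "\<And>i. i \<in> pm n \<Longrightarrow> \<sigma> i \<in> pm n"
    "inj_on \<sigma> (pm n)" "\<And>i. i \<in> pm n \<Longrightarrow> \<sigma> (- i) = - \<sigma> i"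
  shows "\<sigma> \<in> signed_perms n"
proof -
  have "\<sigma> ` pm n = pm n"
    using assms(2,3) by (intro endo_inj_surj) auto
  then have "bij_betw \<sigma> (pm n) (pm n)"
    using assms(3) by (simp add: bij_betw_def)
  then have "\<sigma> permutes pm n"
    using assms(1) by (rule bij_imp_permutes)
  then show ?thesis
    using assms(4) by (simp add: signed_perms_def)
qed

lemma signed_permsD:
  assumes "\<sigma> \<in> signed_perms n"
  shows "i \<notin> pm n \<Longrightarrow> \<sigma> i = i" "i \<in> pm n \<Longrightarrow> \<sigma> i \<in> pm n" "inj \<sigma>" "\<sigma> (- i) = - \<sigma> i"
proof -
  have p: "\<sigma> permutes pm n" and odd: "\<forall>i\<in>pm n. \<sigma> (- i) = - \<sigma> i"
    using assms by (simp_all add: signed_perms_def)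
  show out: "\<sigma> i = i" if "i \<notin> pm n" for i
    using that permutes_not_in[OF p] by blast
  show "i \<in> pm n \<Longrightarrow> \<sigma> i \<in> pm n"
    using permutes_in_image[OF p] by blast
  show "inj \<sigma>"
    using permutes_inj[OF p] .
  show "\<sigma> (- i) = - \<sigma> i"
  proof (cases "i \<in> pm n")
    case False
    then have "- i \<notin> pm n" by auto
    with False show ?thesis by (simp add: out)
  qed (use odd in blast)
qed

lemma finite_signed_perms: "finite (signed_perms n)"
  by (rule finite_subset[of _ "{\<sigma>. \<sigma> permutes pm n}"])
     (auto simp: signed_perms_def finite_permutations)

lemma signed_perms_0: "signed_perms 0 = {id}"
  by (auto simp: signed_perms_def)

text \<open>Standardization: letters of absolute value at least \<open>\<bar>v\<bar>\<close> move
  one step away from 0, which frees \<open>v\<close> and \<open>- v\<close> for a new letter.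
  \<open>drop_val\<close> undoes this.\<close>

definition lift :: "int \<Rightarrow> int \<Rightarrow> int" where
  "lift v u = (if \<bar>u\<bar> < \<bar>v\<bar> then u else u + sgn u)"

definition drop_val :: "int \<Rightarrow> int \<Rightarrow> int" where
  "drop_val v u = (if \<bar>u\<bar> \<le> \<bar>v\<bar> then u else u - sgn u)"

definition snoc_perm :: "nat \<Rightarrow> int \<Rightarrow> (int \<Rightarrow> int) \<Rightarrow> int \<Rightarrow> int" where
  "snoc_perm n v \<tau> i = (if i = int (Suc n) then v else if i = - int (Suc n) then - v
     else if i \<in> pm n then lift v (\<tau> i) else i)"

definition butlast_perm :: "nat \<Rightarrow> (int \<Rightarrow> int) \<Rightarrow> int \<Rightarrow> int" where
  "butlast_perm n \<sigma> i = (if i \<in> pm n then drop_val (\<sigma> (int (Suc n))) (\<sigma> i) else i)"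

lemma snoc_perm_last: "snoc_perm n v \<tau> (int (Suc n)) = v"
  by (simp add: snoc_perm_def)

lemma lift_in_pm: "u \<in> pm n \<Longrightarrow> lift v u \<in> pm (Suc n)"
  by (auto simp: lift_def sgn_if)

lemma lift_uminus: "lift v (- u) = - lift v u"
  by (simp add: lift_def sgn_if)

lemma lift_less_iff: "lift v u < lift v u' \<longleftrightarrow> u < u'"
  by (auto simp: lift_def sgn_if)

lemma lift_eq_iff: "lift v u = lift v u' \<longleftrightarrow> u = u'"
  by (auto simp: lift_def sgn_if split: if_splits)

lemma abs_lift: "v \<noteq> 0 \<Longrightarrow> \<bar>lift v u\<bar> \<noteq> \<bar>v\<bar>"
  by (auto simp: lift_def sgn_if)

lemma drop_lift: "v \<noteq> 0 \<Longrightarrow> u \<noteq> 0 \<Longrightarrow> drop_val v (lift v u) = u"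
  by (auto simp: lift_def drop_val_def sgn_if)

lemma lift_drop: "v \<noteq> 0 \<Longrightarrow> \<bar>u\<bar> \<noteq> \<bar>v\<bar> \<Longrightarrow> lift v (drop_val v u) = u"
  by (auto simp: lift_def drop_val_def sgn_if)

lemma drop_in_pm:
  "\<lbrakk>v \<in> pm (Suc n); u \<in> pm (Suc n); \<bar>u\<bar> \<noteq> \<bar>v\<bar>\<rbrakk> \<Longrightarrow> drop_val v u \<in> pm n"
  by (auto simp: drop_val_def sgn_if)

lemma drop_uminus: "drop_val v (- u) = - drop_val v u"
  by (simp add: drop_val_def sgn_if)

lemma snoc_perm_mem:
  assumes v: "v \<in> pm (Suc n)" and \<tau>: "\<tau> \<in> signed_perms n"
  shows "snoc_perm n v \<tau> \<in> signed_perms (Suc n)"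
proof (rule signed_permsI)
  note D = signed_permsD[OF \<tau>]
  have L: "lift v (\<tau> i) \<noteq> v" "lift v (\<tau> i) \<noteq> - v" for i
    using abs_lift[of v "\<tau> i"] v by auto
  show "inj_on (snoc_perm n v \<tau>) (pm (Suc n))"
  proof (rule inj_onI)
    fix i j assume *: "i \<in> pm (Suc n)" "j \<in> pm (Suc n)" "snoc_perm n v \<tau> i = snoc_perm n v \<tau> j"
    have mid: "i \<in> pm n" if "i \<in> pm (Suc n)" "i \<noteq> int (Suc n)" "i \<noteq> - int (Suc n)" for i
      using that by auto
    show "i = j"
      using *(3) v L L[symmetric] mid[OF *(1)] mid[OF *(2)]
      by (auto simp: snoc_perm_def lift_eq_iff inj_eq[OF D(3)] split: if_splits)
  qed
  show "snoc_perm n v \<tau> i \<in> pm (Suc n)" if "i \<in> pm (Suc n)" for i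
    using that v lift_in_pm[OF D(2)[of i], of v] by (auto simp: snoc_perm_def)
qed (use signed_permsD[OF \<tau>] in \<open>auto simp: snoc_perm_def lift_uminus\<close>)

lemma last_in_pm:
  assumes "\<sigma> \<in> signed_perms (Suc n)"
  shows "\<sigma> (int (Suc n)) \<in> pm (Suc n)"
  by (rule signed_permsD(2)[OF assms]) auto

lemma butlast_perm_mem:
  assumes \<sigma>: "\<sigma> \<in> signed_perms (Suc n)"
  shows "butlast_perm n \<sigma> \<in> signed_perms n"
    and "\<And>i. i \<in> pm n \<Longrightarrow> \<bar>\<sigma> i\<bar> \<noteq> \<bar>\<sigma> (int (Suc n))\<bar>"
proof -
  note D = signed_permsD[OF \<sigma>]
  show ne: "\<bar>\<sigma> i\<bar> \<noteq> \<bar>\<sigma> (int (Suc n))\<bar>" if "i \<in> pm n" for i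
  proof
    assume "\<bar>\<sigma> i\<bar> = \<bar>\<sigma> (int (Suc n))\<bar>"
    \<comment> \<open>Equal absolute values mean equal up to sign, and oddness turns the sign into
      one of the position, so injectivity applies.\<close>
    then have "\<sigma> i = \<sigma> (int (Suc n)) \<or> \<sigma> i = \<sigma> (- int (Suc n))"
      by (simp only: abs_eq_iff D(4)[of "int (Suc n)"])
    then have "i = int (Suc n) \<or> i = - int (Suc n)"
      by (simp only: inj_eq[OF D(3)])
    with that show False by auto
  qed
  note last = last_in_pm[OF \<sigma>]
  then have last0: "\<sigma> (int (Suc n)) \<noteq> 0"
    by simp
  show "butlast_perm n \<sigma> \<in> signed_perms n"
  proof (rule signed_permsI)
    show "inj_on (butlast_perm n \<sigma>) (pm n)"
    proof (rule inj_onI)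
      fix i j assume *: "i \<in> pm n" "j \<in> pm n" "butlast_perm n \<sigma> i = butlast_perm n \<sigma> j"
      then have "lift (\<sigma> (int (Suc n))) (drop_val (\<sigma> (int (Suc n))) (\<sigma> i)) =
          lift (\<sigma> (int (Suc n))) (drop_val (\<sigma> (int (Suc n))) (\<sigma> j))"
        by (simp add: butlast_perm_def)
      then show "i = j"
        by (simp only: lift_drop[OF last0 ne[OF *(1)]] lift_drop[OF last0 ne[OF *(2)]] inj_eq[OF D(3)])
    qed
    show "butlast_perm n \<sigma> i \<in> pm n" if "i \<in> pm n" for i
    proof -
      have "i \<in> pm (Suc n)" using that by auto
      then show ?thesis
        using drop_in_pm[OF last D(2) ne[OF that]] that by (simp add: butlast_perm_def)
    qed
  qed (auto simp: butlast_perm_def D(4) drop_uminus)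
qed

lemma snoc_butlast_perm:
  assumes \<sigma>: "\<sigma> \<in> signed_perms (Suc n)"
  shows "snoc_perm n (\<sigma> (int (Suc n))) (butlast_perm n \<sigma>) = \<sigma>"
proof
  fix i
  note D = signed_permsD[OF \<sigma>]
  consider "i = int (Suc n)" | "i = - int (Suc n)" | "i \<in> pm n" | "i \<notin> pm (Suc n)" by force
  then show "snoc_perm n (\<sigma> (int (Suc n))) (butlast_perm n \<sigma>) i = \<sigma> i"
  proof cases
    case 2
    then show ?thesis
      using D(4)[of "int (Suc n)"] by (auto simp: snoc_perm_def)
  next
    case 3
    then show ?thesis
      using lift_drop[OF _ butlast_perm_mem(2)[OF \<sigma> 3]] last_in_pm[OF \<sigma>]
      by (auto simp: snoc_perm_def butlast_perm_def)
  next
    case 4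
    then show ?thesis
      using D(1)[OF 4] by (auto simp: snoc_perm_def)
  qed (simp add: snoc_perm_def)
qed

lemma butlast_snoc_perm:
  assumes v: "v \<in> pm (Suc n)" and \<tau>: "\<tau> \<in> signed_perms n"
  shows "butlast_perm n (snoc_perm n v \<tau>) = \<tau>"
proof
  fix i
  note D = signed_permsD[OF \<tau>]
  show "butlast_perm n (snoc_perm n v \<tau>) i = \<tau> i"
  proof (cases "i \<in> pm n")
    case True
    then show ?thesis
      using D(2)[OF True] drop_lift[of v "\<tau> i"] v by (auto simp: butlast_perm_def snoc_perm_def)
  next
    case False
    then show ?thesis
      using D(1)[OF False] by (auto simp: butlast_perm_def)
  qed
qed

text \<open>A signed permutation corresponds to its last letter together with the standardization of
  the letters before it.\<close>

lemma sum_signed_perms_Suc: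
  "(\<Sum>\<sigma>\<in>signed_perms (Suc n). G \<sigma>) = (\<Sum>v\<in>pm (Suc n). \<Sum>\<tau>\<in>signed_perms n. G (snoc_perm n v \<tau>))"
proof -
  have "(\<Sum>\<sigma>\<in>signed_perms (Suc n). G \<sigma>) =
      (\<Sum>p\<in>pm (Suc n) \<times> signed_perms n. G (snoc_perm n (fst p) (snd p)))"
    by (rule sum.reindex_bij_witness[where i = "\<lambda>p. snoc_perm n (fst p) (snd p)"
          and j = "\<lambda>\<sigma>. (\<sigma> (int (Suc n)), butlast_perm n \<sigma>)"])
       (simp_all only: snoc_butlast_perm butlast_snoc_perm snoc_perm_mem butlast_perm_mem(1) last_in_pm
          mem_Times_iff fst_conv snd_conv snoc_perm_last prod.collapse)
  then show ?thesis
    by (simp add: sum.cartesian_product case_prod_beta)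
qed

section \<open>Descents, signs and generating functions by the last letter\<close>

definition neg_count :: "nat \<Rightarrow> (int \<Rightarrow> int) \<Rightarrow> nat" where
  "neg_count n \<sigma> = card {i \<in> {1..int n}. \<sigma> i < 0}"

text \<open>All affine descents except the one at the right end \<open>n\<close>, that is, the
  ordinary type \<open>D\<close> descent number.\<close>

definition des_left :: "nat \<Rightarrow> (int \<Rightarrow> int) \<Rightarrow> nat" where
  "des_left n \<sigma> = of_bool (\<sigma> 1 + \<sigma> 2 < 0) + card {i \<in> {1..int n - 1}. \<sigma> i > \<sigma> (i + 1)}"

lemma snoc_perm_below: "i \<in> {1..int n} \<Longrightarrow> snoc_perm n v \<tau> i = lift v (\<tau> i)"
  by (auto simp: snoc_perm_def)

lemma lift_less_0_iff: "lift v u < 0 \<longleftrightarrow> u < 0"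
  by (auto simp: lift_def sgn_if)

text \<open>\<open>lift v\<close> is odd and strictly increasing, so it preserves the comparison of
  \<open>u\<close> with \<open>- u'\<close>. Hence the descent at 0 survives
  standardization.\<close>

lemma lift_add_less_0_iff: "lift v u + lift v u' < 0 \<longleftrightarrow> u + u' < 0"
proof -
  have "x + y < 0 \<longleftrightarrow> x < - y" for x y :: int
    by linarith
  then show ?thesis
    by (simp only: lift_uminus[symmetric] lift_less_iff)
qed

lemma card_Collect_insert:
  fixes k :: int
  assumes "k \<ge> 0"
  shows "card {i \<in> {1..k + 1}. P i} = card {i \<in> {1..k}. P i} + of_bool (P (k + 1))"
proof -
  let ?A = "{i \<in> {1..k}. P i}"
  have eq: "{i \<in> {1..k + 1}. P i} = (if P (k + 1) then insert (k + 1) ?A else ?A)"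
    using assms by (auto simp: order_le_less)
  have "k + 1 \<notin> ?A" "finite ?A"
    by (auto intro: finite_subset[of _ "{1..k}"])
  then show ?thesis
    unfolding eq by (simp del: mem_Collect_eq)
qed

lemma neg_count_snoc: "neg_count (Suc n) (snoc_perm n v \<tau>) = neg_count n \<tau> + of_bool (v < 0)"
proof -
  have "{i \<in> {1..int n}. snoc_perm n v \<tau> i < 0} = {i \<in> {1..int n}. \<tau> i < 0}"
    by (auto simp: snoc_perm_below lift_less_0_iff)
  then show ?thesis
    using card_Collect_insert[of "int n" "\<lambda>i. snoc_perm n v \<tau> i < 0"]
    by (simp add: neg_count_def add.commute snoc_perm_def)
qed

text \<open>From two letters on, the descent at 0 sees only old letters, and standardization keeps
  all old comparisons; the only new one is at position \<open>n\<close>.\<close>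

lemma des_left_snoc:
  assumes "n \<ge> 2"
  shows "des_left (Suc n) (snoc_perm n v \<tau>) = des_left n \<tau> + of_bool (lift v (\<tau> (int n)) > v)"
proof -
  have "{i \<in> {1..int n - 1}. snoc_perm n v \<tau> i > snoc_perm n v \<tau> (i + 1)} =
      {i \<in> {1..int n - 1}. \<tau> i > \<tau> (i + 1)}"
    by (auto simp: snoc_perm_below lift_less_iff)
  moreover have "snoc_perm n v \<tau> (int n + 1) = v"
    by (simp add: snoc_perm_def)
  ultimately show ?thesis
    using card_Collect_insert[of "int n - 1" "\<lambda>i. snoc_perm n v \<tau> i > snoc_perm n v \<tau> (i + 1)"] assms
    by (simp add: des_left_def snoc_perm_below lift_add_less_0_iff)
qed

lemma card_affine_Des_D:
  assumes "n \<ge> 1"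
  shows "card (affine_Des_D n \<sigma>) = des_left n \<sigma> + of_bool (\<sigma> (int n - 1) + \<sigma> (int n) > 0)"
proof -
  define A where "A = {i \<in> {1..int n - 1}. \<sigma> i > \<sigma> (i + 1)}"
  have "finite A" "0 \<notin> A" "int n \<notin> A"
    unfolding A_def by (rule finite_subset[of _ "{1..int n - 1}"]) auto
  then show ?thesis
    using assms unfolding affine_Des_D_def des_left_def A_def[symmetric] by simp
qed

text \<open>Both parities of the number of negative letters are carried along (\<open>b\<close> is
  true for even), because appending a negative letter exchanges them.\<close>

definition last_gf :: "complex \<Rightarrow> nat \<Rightarrow> bool \<Rightarrow> int \<Rightarrow> complex" where
  "last_gf z n b w = (\<Sum>\<sigma>\<in>signed_perms n.
     if even (neg_count n \<sigma>) = b \<and> \<sigma> (int n) = w then z ^ des_left n \<sigma> else 0)"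

lemma sum_by_last:
  assumes "n \<ge> 1"
  shows "(\<Sum>\<tau>\<in>signed_perms n. if even (neg_count n \<tau>) = b then h (\<tau> (int n)) * z ^ des_left n \<tau> else 0) =
    (\<Sum>w\<in>pm n. h w * last_gf z n b w)"
proof -
  have "(\<Sum>w\<in>pm n. h w * last_gf z n b w) = (\<Sum>\<tau>\<in>signed_perms n. \<Sum>w\<in>pm n.
      if \<tau> (int n) = w then (if even (neg_count n \<tau>) = b then h w * z ^ des_left n \<tau> else 0) else 0)"
    unfolding last_gf_def sum_distrib_left by (subst sum.swap) (intro sum.cong refl, simp)
  also have "\<dots> = (\<Sum>\<tau>\<in>signed_perms n. if even (neg_count n \<tau>) = b then h (\<tau> (int n)) * z ^ des_left n \<tau> else 0)"
  proof (intro sum.cong refl)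
    fix \<tau> assume "\<tau> \<in> signed_perms n"
    then have "\<tau> (int n) \<in> pm n"
      by (rule signed_permsD(2)) (use assms in auto)
    then show "(\<Sum>w\<in>pm n. if \<tau> (int n) = w then (if even (neg_count n \<tau>) = b then h w * z ^ des_left n \<tau> else 0) else 0) =
      (if even (neg_count n \<tau>) = b then h (\<tau> (int n)) * z ^ des_left n \<tau> else 0)"
      by (subst sum.delta') simp_all
  qed
  finally show ?thesis ..
qed

lemma last_gf_Suc:
  assumes n: "n \<ge> 2" and v: "v \<in> pm (Suc n)"
  shows "last_gf z (Suc n) b v =
    (\<Sum>w\<in>pm n. (if lift v w > v then z else 1) * last_gf z n (b \<longleftrightarrow> v > 0) w)"
proof -
  have par: "(even (neg_count n \<tau> + of_bool (v < 0)) = b) = (even (neg_count n \<tau>) = (b \<longleftrightarrow> v > 0))" for \<tau>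
    using v by auto
  have "last_gf z (Suc n) b v = (\<Sum>v'\<in>pm (Suc n). if v' = v then
      (\<Sum>\<tau>\<in>signed_perms n. if even (neg_count (Suc n) (snoc_perm n v \<tau>)) = b
         then z ^ des_left (Suc n) (snoc_perm n v \<tau>) else 0) else 0)"
    unfolding last_gf_def sum_signed_perms_Suc
    by (intro sum.cong refl) (auto simp: snoc_perm_last simp del: of_nat_Suc)
  also have "\<dots> = (\<Sum>\<tau>\<in>signed_perms n. if even (neg_count (Suc n) (snoc_perm n v \<tau>)) = b
         then z ^ des_left (Suc n) (snoc_perm n v \<tau>) else 0)"
    using v by (subst sum.delta) auto
  also have "\<dots> = (\<Sum>\<tau>\<in>signed_perms n. if even (neg_count n \<tau>) = (b \<longleftrightarrow> v > 0)
         then (if lift v (\<tau> (int n)) > v then z else 1) * z ^ des_left n \<tau> else 0)"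
    unfolding neg_count_snoc des_left_snoc[OF n] par by (intro sum.cong refl) auto
  also have "\<dots> = (\<Sum>w\<in>pm n. (if lift v w > v then z else 1) * last_gf z n (b \<longleftrightarrow> v > 0) w)"
    using n by (intro sum_by_last) auto
  finally show ?thesis .
qed

lemma pm_1: "pm (Suc 0) = {-1, 1}" and pm_2: "pm (Suc (Suc 0)) = {-2, -1, 1, 2}"
  by auto

lemma sum_signed_perms_2:
  "(\<Sum>\<sigma>\<in>signed_perms 2. G \<sigma>) =
    (\<Sum>v\<in>{-2, -1, 1, 2}. \<Sum>u\<in>{-1, 1}. G (snoc_perm (Suc 0) v (snoc_perm 0 u id)))"
  unfolding numeral_2_eq_2 sum_signed_perms_Suc pm_1 pm_2 signed_perms_0 by simp

text \<open>The start of the recursion, found by running through the eight signed permutations of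
  two letters. The value is the same for both parities.\<close>

lemma last_gf_2:
  assumes w: "w \<in> {-2, -1, 1, 2}"
  shows "last_gf z 2 b w = (if w = -2 then z\<^sup>2 else if w = 2 then 1 else z)"
proof -
  have neg: "neg_count 2 (snoc_perm (Suc 0) v (snoc_perm 0 u id)) = of_bool (v < 0) + of_bool (u < 0)" for u v
    using neg_count_snoc[of "Suc 0" v "snoc_perm 0 u id"] neg_count_snoc[of 0 u id]
    by (simp add: numeral_2_eq_2[symmetric] neg_count_def)
  have vals: "snoc_perm (Suc 0) v (snoc_perm 0 u id) 1 = lift v u"
    "snoc_perm (Suc 0) v (snoc_perm 0 u id) 2 = v" for u v
    by (simp_all add: snoc_perm_def)
  have des: "des_left 2 \<sigma> = of_bool (\<sigma> 1 + \<sigma> 2 < 0) + of_bool (\<sigma> 1 > \<sigma> 2)" for \<sigma> :: "int \<Rightarrow> int"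
    using card_Collect_insert[of 0 "\<lambda>i. \<sigma> i > \<sigma> (i + 1)"] by (simp add: des_left_def)
  have "last_gf z 2 b w = (\<Sum>v\<in>{-2, -1, 1, 2}. \<Sum>u\<in>{-1, 1}.
      if even (of_bool (v < 0) + of_bool (u < 0) :: nat) = b \<and> v = w
      then z ^ (of_bool (lift v u + v < 0) + of_bool (lift v u > v)) else 0)"
    unfolding last_gf_def sum_signed_perms_2 by (simp only: of_nat_numeral neg des vals)
  also have "\<dots> = (if w = -2 then z\<^sup>2 else if w = 2 then 1 else z)"
    using w by (cases b) (auto simp: lift_def power2_eq_square)
  finally show ?thesis .
qed

text \<open>Deleting the last letter \<open>v\<close> leaves two weights: the descent before
  \<open>v\<close> compares the previous letter with \<open>v\<close>, and the descent at the right
  end compares it with \<open>- v\<close>. The prefix has to be even exactly when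
  \<open>v > 0\<close>.\<close>

lemma sum_weyl_D:
  assumes n: "n \<ge> 2"
  shows "(\<Sum>\<sigma>\<in>weyl_D (Suc n). z ^ card (affine_Des_D (Suc n) \<sigma>)) =
    (\<Sum>v\<in>pm (Suc n). \<Sum>w\<in>pm n.
       (if lift v w > v then z else 1) * (if lift v w > - v then z else 1) * last_gf z n (v > 0) w)"
proof -
  let ?h = "\<lambda>v w. (if lift v w > v then z else 1) * (if lift v w > - v then z else 1)"
  have "(\<Sum>\<sigma>\<in>weyl_D (Suc n). z ^ card (affine_Des_D (Suc n) \<sigma>)) =
     (\<Sum>\<sigma>\<in>signed_perms (Suc n). if even (neg_count (Suc n) \<sigma>) then z ^ card (affine_Des_D (Suc n) \<sigma>) else 0)"
    unfolding weyl_D_def neg_count_def by (rule sum.inter_filter) (rule finite_signed_perms)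
  also have "\<dots> = (\<Sum>v\<in>pm (Suc n). \<Sum>\<tau>\<in>signed_perms n.
      if even (neg_count n \<tau>) = (v > 0) then ?h v (\<tau> (int n)) * z ^ des_left n \<tau> else 0)"
    unfolding sum_signed_perms_Suc
  proof (intro sum.cong refl)
    fix v \<tau> assume v: "v \<in> pm (Suc n)"
    have pos: "lift v (\<tau> (int n)) + v > 0 \<longleftrightarrow> lift v (\<tau> (int n)) > - v"
      by linarith
    have par: "even (neg_count n \<tau> + of_bool (v < 0)) = (even (neg_count n \<tau>) = (v > 0))"
      using v by auto
    have c: "card (affine_Des_D (Suc n) (snoc_perm n v \<tau>)) =
        des_left n \<tau> + of_bool (lift v (\<tau> (int n)) > v) + of_bool (lift v (\<tau> (int n)) > - v)"
      using n by (simp add: card_affine_Des_D des_left_snoc snoc_perm_below snoc_perm_last[simplified] pos)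
    show "(if even (neg_count (Suc n) (snoc_perm n v \<tau>))
          then z ^ card (affine_Des_D (Suc n) (snoc_perm n v \<tau>)) else 0) =
         (if even (neg_count n \<tau>) = (v > 0) then ?h v (\<tau> (int n)) * z ^ des_left n \<tau> else 0)"
      unfolding neg_count_snoc par c by auto
  qed
  also have "\<dots> = (\<Sum>v\<in>pm (Suc n). \<Sum>w\<in>pm n. ?h v w * last_gf z n (v > 0) w)"
    using n by (intro sum.cong[OF refl]; intro sum_by_last) auto
  finally show ?thesis .
qed

section \<open>Reduction to a solution of the recursion\<close>

definition val :: "nat \<Rightarrow> nat \<Rightarrow> int" where
  "val n p = (if p < n then int n - int p else int n - 1 - int p)"

lemma bij_betw_val: "bij_betw (val n) {..<2 * n} (pm n)"
proof (rule bij_betwI[where g = "\<lambda>v. if v > 0 then nat (int n - v) else nat (int n - 1 - v)"])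
  show "val n \<in> {..<2 * n} \<rightarrow> pm n"
    by (auto simp: val_def)
qed (auto simp: val_def nat_less_iff split: if_splits)

lemma val_in_pm: "p < 2 * n \<Longrightarrow> val n p \<in> pm n"
  using bij_betw_apply[OF bij_betw_val] by blast

lemma sum_pm: "(\<Sum>v\<in>pm n. h v) = (\<Sum>p<2 * n. h (val n p))"
  by (rule sum.reindex_bij_betw[OF bij_betw_val, symmetric])

text \<open>\<open>val\<close> lists the letters in decreasing order, so those above the new letter
  form an initial segment. The new letters 1 and -1, at \<open>i = m\<close> and
  \<open>i = m + 1\<close>, share the segment of length \<open>m\<close>.\<close>

lemma lift_val_less:
  assumes "p < 2 * m" "i < 2 * m + 2"
  shows "val (Suc m) i < lift (val (Suc m) i) (val m p) \<longleftrightarrow> p < (if i \<le> m then i else i - 1)"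
  using assms by (auto simp: val_def lift_def sgn_if)

lemma uminus_val: "i < 2 * m + 2 \<Longrightarrow> - val (Suc m) i = val (Suc m) (2 * m + 1 - i)"
  by (auto simp: val_def)

lemma step_if:
  assumes "i < 2 * m + 2"
  shows "step m z f i = (\<Sum>p<2*m. (if p < (if i \<le> m then i else i - 1) then z else 1) * f p)"
proof -
  define c where "c = (if i \<le> m then i else i - 1)"
  have c: "c \<le> 2 * m"
    using assms by (auto simp: c_def)
  have "(\<Sum>p<2*m. (if p < c then z else 1) * f p) =
      (\<Sum>p<c. (if p < c then z else 1) * f p) + (\<Sum>p=c..<2*m. (if p < c then z else 1) * f p)"
    by (rule lessThan_split[OF c, symmetric])
  also have "\<dots> = z * (\<Sum>p<c. f p) + (\<Sum>p=c..<2*m. f p)"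
    by (simp add: sum_distrib_left)
  finally show ?thesis
    by (simp add: step_def c_def Let_def)
qed

text \<open>The index of \<open>left_seq\<close> is the level minus 2, that of \<open>aff_seq\<close> below is the level minus 3.\<close>

primrec left_seq :: "complex \<Rightarrow> nat \<Rightarrow> nat \<Rightarrow> complex" where
  "left_seq z 0 = (\<lambda>p. if p = 0 then 1 else if p = 3 then z\<^sup>2 else z)"
| "left_seq z (Suc k) = step (k + 2) z (left_seq z k)"

text \<open>The parity \<open>b\<close> drops out: it does so at level 2, and the recursion merely
  replaces \<open>b\<close> by another parity.\<close>

lemma last_gf_val:
  "p < 2 * (k + 2) \<Longrightarrow> last_gf z (k + 2) b (val (k + 2) p) = left_seq z k p"
proof (induction k arbitrary: p b)
  case 0
  then have p: "p \<in> {0, 1, 2, 3}"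
    by auto
  then have "val 2 p \<in> {-2, -1, 1, 2}"
    by (auto simp: val_def)
  then show ?case
    unfolding add_0 using p by (auto simp: last_gf_2 val_def)
next
  case (Suc k)
  define n where "n = k + 2"
  have IH: "last_gf z n b (val n q) = left_seq z k q" if "q < 2 * n" for q b
    using Suc.IH that by (simp only: n_def)
  have n: "n \<ge> 2" and p: "p < 2 * n + 2"
    using Suc.prems by (simp_all add: n_def)
  let ?v = "val (Suc n) p"
  have v: "?v \<in> pm (Suc n)"
    using p by (intro val_in_pm) simp
  have "last_gf z (Suc n) b ?v =
     (\<Sum>q<2 * n. (if ?v < lift ?v (val n q) then z else 1) * last_gf z n (b \<longleftrightarrow> ?v > 0) (val n q))"
    unfolding last_gf_Suc[OF n v] sum_pm ..
  also have "\<dots> = (\<Sum>q<2 * n. (if q < (if p \<le> n then p else p - 1) then z else 1) * left_seq z k q)"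
    using p by (intro sum.cong refl) (simp only: IH lift_val_less lessThan_iff)
  also have "\<dots> = left_seq z (Suc k) p"
    using step_if[OF p] by (simp add: n_def)
  finally show ?case
    by (simp add: n_def)
qed

section \<open>Pairing \<open>v\<close> with \<open>- v\<close>, and the right end of type
  \<open>D\<close>\<close>

lemma sum_lessThan_fold:
  fixes h :: "nat \<Rightarrow> 'a :: comm_monoid_add"
  shows "(\<Sum>i<2 * N. h i) = (\<Sum>i<N. h i + h (2 * N - 1 - i))"
proof -
  have "(\<Sum>i<N. h (N + i)) = (\<Sum>i<N. h (N + (N - 1 - i)))"
    using sum.nat_diff_reindex[of "\<lambda>i. h (N + i)" N] by simp
  also have "\<dots> = (\<Sum>i<N. h (2 * N - 1 - i))"
    by (intro sum.cong refl) (simp add: mult_2)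
  finally show ?thesis
    using sum_lessThan_add[of h N N] by (simp add: mult_2 sum.distrib)
qed

text \<open>The middle cut gives weight \<open>z\<close> to the positive last letters, which is a
  right end of type \<open>C\<close>.\<close>

lemma step_middle: "step n z g n = (\<Sum>i<n. z * g i + g (2 * n - 1 - i))"
proof -
  have "step n z g n = (\<Sum>i<2 * n. (if i < n then z else 1) * g i)"
    by (simp add: step_if)
  also have "\<dots> = (\<Sum>i<n. z * g i + g (2 * n - 1 - i))"
    unfolding sum_lessThan_fold by (intro sum.cong refl) auto
  finally show ?thesis .
qed

lemma step_diff: "step m z (\<lambda>i. f i - g i) i = step m z f i - step m z g i"
  by (simp add: step_def Let_def sum_subtractf algebra_simps)

lemma step_cong: "(\<And>j. j < 2 * m \<Longrightarrow> f j = g j) \<Longrightarrow> i < 2 * m + 2 \<Longrightarrow> step m z f i = step m z g i"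
  by (simp add: step_if)

lemma shift_cong:
  assumes "\<And>j. j < 2 * m \<Longrightarrow> f j = g j" "q < 2 * m + 2"
  shows "shift m z f q = shift m z g q"
proof -
  have eq: "of_nat a * f b = of_nat a * g b" if "a = 0 \<or> b < 2 * m" for a b
    using that assms(1) by auto
  show ?thesis
  proof (cases "q \<le> m")
    case True
    then show ?thesis
      by (simp only: shift_def if_True, intro arg_cong2[where f = "(+)"] eq) auto
  next
    case False
    then show ?thesis
      using assms(2)
      by (simp only: shift_def if_False, intro arg_cong2[where f = "(+)"] arg_cong2[where f = "(*)"] eq refl) auto
  qed
qed

text \<open>The lower half of the shift comes from the upper half of \<open>f\<close> and gets its
  \<open>z\<close> from the cut; the upper half comes from the lower half of \<open>f\<close> and
  has a \<open>z\<close> from the translation. Thus all of \<open>f\<close> enters with the same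
  factor.\<close>

lemma step_shift_middle:
  "step (m + 1) z (shift m z f) (m + 1) = of_nat (m + 1) * z * (\<Sum>p<2 * m. f p)"
proof -
  have "step (m + 1) z (shift m z f) (m + 1) =
      (\<Sum>q<2 * m + 2. shift m z f q) - (1 - z) * (\<Sum>q<m + 1. shift m z f q)"
    using step_eq[of "m + 1" "m + 1" z "shift m z f"] by simp
  moreover have "(\<Sum>q<m + 1. shift m z f q) = of_nat (m + 1) * (\<Sum>q<m. f (m + q))"
    by (simp add: sum_shift_low del: sum.lessThan_Suc)
  moreover have "(\<Sum>p<2 * m. f p) = (\<Sum>p<m. f p) + (\<Sum>q<m. f (m + q))"
    using sum_lessThan_add[of f m m] by (simp add: mult_2)
  ultimately show ?thesis
    unfolding sum_shift_total by (simp only:) (simp add: algebra_simps)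
qed

text \<open>
  For fixed \<open>w\<close>, the letters \<open>v\<close> and \<open>- v\<close> together contribute equal amounts to both sides.
\<close>

lemma weights_fold:
  fixes h :: "int \<Rightarrow> complex"
  shows "(\<Sum>v\<in>pm (Suc m). \<Sum>w\<in>pm m. (if lift v w > v then z else 1) * (if lift v w > - v then z else 1) * h w) =
    2 * step (m + 1) z (\<lambda>i. step m z (\<lambda>p. h (val m p)) i - shift m z (\<lambda>p. h (val m p)) i) (m + 1)"
proof -
  define f where "f p = h (val m p)" for p
  define c where "c i = (if i \<le> m then i else i - 1)" for i
  define G where "G i = (\<Sum>p<2 * m. (if p < c i then z else 1) * (if p < c (2 * m + 1 - i) then z else 1) * f p)" for i
  have "(\<Sum>v\<in>pm (Suc m). \<Sum>w\<in>pm m. (if lift v w > v then z else 1) * (if lift v w > - v then z else 1) * h w) =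
     (\<Sum>i<2 * (m + 1). G i)"
  proof -
    have lift_neg: "lift (- v) w = lift v w" for v w
      by (simp add: lift_def)
    have "lift (val (Suc m) i) (val m p) > - val (Suc m) i \<longleftrightarrow> p < c (2 * m + 1 - i)"
      if "i < 2 * m + 2" "p < 2 * m" for i p
      using lift_val_less[of p m "2 * m + 1 - i"] that uminus_val[of i m] lift_neg[of "val (Suc m) i"]
      by (simp add: c_def)
    then show ?thesis
      unfolding sum_pm G_def f_def
      by (intro sum.cong) (auto simp: lift_val_less c_def)
  qed
  also have "\<dots> = (\<Sum>i<m + 1. G i + G (2 * m + 1 - i))"
    unfolding sum_lessThan_fold by (rule sum.cong) simp_all
  also have "\<dots> = (\<Sum>i<m + 1. 2 * (z * step m z f i + step m z f (2 * m + 1 - i) - z * (\<Sum>p<2*m. f p)))"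
  proof (intro sum.cong refl)
    fix i assume "i \<in> {..<m + 1}"
    then have i: "i \<le> m" by simp
    have ci: "c i = i" "c (2 * m + 1 - i) = 2 * m - i"
      using i by (auto simp: c_def)
    have "z * step m z f i + step m z f (2 * m + 1 - i) - z * (\<Sum>p<2*m. f p) =
      (\<Sum>p<2*m. z * ((if p < c i then z else 1) * f p) + (if p < c (2 * m + 1 - i) then z else 1) * f p - z * f p)"
      using i step_if[of i m z f] step_if[of "2 * m + 1 - i" m z f]
      by (simp add: c_def sum.distrib sum_subtractf sum_distrib_left)
    \<comment> \<open>Let \<open>x\<close> and \<open>y\<close> be the weights of \<open>p\<close>
      for the cuts \<open>i \<le> 2 * m - i\<close>. Either \<open>x = 1\<close> or
      \<open>y = z\<close>, so \<open>(x - 1) * (y - z) = 0\<close>, which reads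
      \<open>x * y = z * x + y - z\<close>.\<close>
    also have "\<dots> = G i"
      unfolding G_def ci using i by (intro sum.cong refl) auto
    finally have "z * step m z f i + step m z f (2 * m + 1 - i) - z * (\<Sum>p<2*m. f p) = G i" .
    moreover have "G (2 * m + 1 - i) = G i"
      using i by (simp add: G_def mult.commute)
    ultimately show "G i + G (2 * m + 1 - i) = 2 * (z * step m z f i + step m z f (2 * m + 1 - i) - z * (\<Sum>p<2*m. f p))"
      by simp
  qed
  \<comment> \<open>The first two terms add up to the type \<open>C\<close> end of
    \<open>step m z f\<close>; the \<open>m + 1\<close> subtracted totals are the middle value of
    the shift.\<close>
  also have "\<dots> = 2 * (step (m + 1) z (step m z f) (m + 1) - step (m + 1) z (shift m z f) (m + 1))"
    unfolding step_middle[of "m + 1" z "step m z f"] step_shift_middle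
    by (simp add: sum_distrib_left sum_subtractf algebra_simps)
  finally show ?thesis
    unfolding step_diff f_def .
qed

definition aff_seq :: "complex \<Rightarrow> nat \<Rightarrow> nat \<Rightarrow> complex" where
  "aff_seq z k i = left_seq z (Suc k) i - shift (k + 2) z (left_seq z k) i"

text \<open>Both parts of the difference solve the recursion, the second one by
  \<open>step_shift\<close>, and the recursion is linear.\<close>

lemma aff_seq_Suc:
  assumes "i < 2 * k + 8"
  shows "aff_seq z (Suc k) i = step (k + 3) z (aff_seq z k) i"
  using step_shift[of i "k + 2" z "left_seq z k"] assms
  unfolding aff_seq_def step_diff by (simp add: numeral_eq_Suc)

text \<open>As \<open>last_gf\<close> ignores parity, \<open>weights_fold\<close> applies with
  \<open>last_gf z (k + 2) True\<close> for every \<open>v\<close>. The result is the entry at the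
  middle cut, one level above \<open>k + 3\<close>.\<close>

lemma sum_weyl_D_aff_seq:
  "(\<Sum>\<sigma>\<in>weyl_D (k + 3). z ^ card (affine_Des_D (k + 3) \<sigma>)) = 2 * aff_seq z (Suc k) (k + 3)"
proof -
  define n where "n = k + 2"
  have n: "n \<ge> 2"
    by (simp add: n_def)
  have gf: "last_gf z n b (val n p) = left_seq z k p" if "p < 2 * n" for b p
    using last_gf_val that by (simp only: n_def)
  have eq: "last_gf z n b w = last_gf z n True w" if w: "w \<in> pm n" for b w
  proof -
    obtain p where "p < 2 * n" "w = val n p"
      using w unfolding bij_betw_imp_surj_on[OF bij_betw_val, symmetric] by blast
    then show ?thesis
      by (simp only: gf)
  qed
  have "(\<Sum>\<sigma>\<in>weyl_D (Suc n). z ^ card (affine_Des_D (Suc n) \<sigma>)) =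
    (\<Sum>v\<in>pm (Suc n). \<Sum>w\<in>pm n.
       (if lift v w > v then z else 1) * (if lift v w > - v then z else 1) * last_gf z n True w)"
    unfolding sum_weyl_D[OF n]
    by (intro sum.cong refl arg_cong2[where f = "(*)"]) (rule eq)
  also have "\<dots> = 2 * step (n + 1) z (\<lambda>i. step n z (left_seq z k) i - shift n z (left_seq z k) i) (n + 1)"
    unfolding weights_fold
    by (intro arg_cong[where f = "\<lambda>x. 2 * x"] step_cong arg_cong2[where f = "(-)"] shift_cong)
       (auto simp: gf)
  also have "(\<lambda>i. step n z (left_seq z k) i - shift n z (left_seq z k) i) = aff_seq z k"
    by (simp add: aff_seq_def n_def fun_eq_iff)
  finally show ?thesis
    using aff_seq_Suc[of "k + 3" k z] by (simp add: n_def numeral_eq_Suc)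
qed

section \<open>The first levels\<close>

abbreviation nat_poly :: "nat list \<Rightarrow> complex \<Rightarrow> complex" where
  "nat_poly cs z \<equiv> horner_sum of_nat z cs"

text \<open>The three-term Pluecker relation for 2 by 2 determinants, which replaces arguments about
  angles: the sign of one pair follows from those of the other five.\<close>

lemma crs_plucker: "crs a b * crs c r + crs a r * crs b c = crs a c * crs b r"
  unfolding crs_def by (simp add: algebra_simps)

lemma cnj_nat_poly: "cnj (nat_poly cs z) = nat_poly cs (cnj z)"
  by (induction cs) simp_all

lemma nat_poly_rev:
  assumes "z \<noteq> 0" "cs \<noteq> []"
  shows "nat_poly (rev cs) z = z ^ (length cs - 1) * nat_poly cs (inverse z)"
proof -
  have "z * nat_poly (rev cs) z = z ^ length cs * nat_poly cs (inverse z)"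
    using assms(1) by (induction cs) (simp_all add: horner_sum_append field_simps)
  also have "\<dots> = z * (z ^ (length cs - 1) * nat_poly cs (inverse z))"
    using assms(2) by (cases cs) simp_all
  finally show ?thesis
    using assms(1) by simp
qed

text \<open>Divided by \<open>z - cnj z\<close>, the left side of \<open>bezout\<close> is
  \<open>D\<close> times the Bezoutian of \<open>g\<close> and \<open>f\<close> at \<open>z\<close>
  and \<open>cnj z\<close>, a Hermitian form in the powers of \<open>z\<close>. The list
  \<open>ps\<close> writes it as a weighted sum of squares, with \<open>D\<close> clearing
  denominators.\<close>

lemma crs_pos_of_bezout:
  fixes ps :: "(nat \<times> nat list) list"
  assumes z: "Im z > 0" and D: "D > 0"
    and bezout: "of_nat D * (nat_poly g z * nat_poly f (cnj z) - nat_poly g (cnj z) * nat_poly f z) =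
      (z - cnj z) * (\<Sum>(d, p)\<leftarrow>ps. of_nat d * (nat_poly p z * nat_poly p (cnj z)))"
    and nonzero: "\<exists>(d, p) \<in> set ps. d > 0 \<and> nat_poly p z \<noteq> 0"
  shows "crs (nat_poly f z) (nat_poly g z) > 0"
proof -
  define S where "S = (\<Sum>(d, p)\<leftarrow>ps. real d * (cmod (nat_poly p z))\<^sup>2)"
  have "(\<Sum>(d, p)\<leftarrow>ps. of_nat d * (nat_poly p z * nat_poly p (cnj z))) = complex_of_real S"
    unfolding S_def
    by (induction ps) (auto simp: cnj_nat_poly[symmetric] complex_mult_cnj cmod_power2 simp flip: of_real_power)
  moreover have "nat_poly g z * nat_poly f (cnj z) - nat_poly g (cnj z) * nat_poly f z =
      2 * \<i> * of_real (crs (nat_poly f z) (nat_poly g z))"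
    unfolding crs_def cnj_nat_poly[symmetric] by (simp add: complex_eq_iff)
  moreover have "z - cnj z = 2 * \<i> * of_real (Im z)"
    by (simp add: complex_eq_iff)
  ultimately have "2 * \<i> * complex_of_real (real D * crs (nat_poly f z) (nat_poly g z)) = 2 * \<i> * complex_of_real (Im z * S)"
    using bezout by (simp add: mult_ac)
  then have eq: "real D * crs (nat_poly f z) (nat_poly g z) = Im z * S"
    by (simp only: mult_cancel_left of_real_eq_iff) simp
  have "S > 0"
    using nonzero unfolding S_def
  proof (induction ps)
    case (Cons a ps)
    obtain d p where a: "a = (d, p)" by fastforce
    have nn: "(\<Sum>(d, p)\<leftarrow>ps. real d * (cmod (nat_poly p z))\<^sup>2) \<ge> 0"
      by (induction ps) auto
    show ?case
    proof (cases "d > 0 \<and> nat_poly p z \<noteq> 0")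
      case True
      then have "real d * (cmod (nat_poly p z))\<^sup>2 > 0" by simp
      with nn show ?thesis by (simp add: a)
    next
      case False
      with Cons have "(\<Sum>(d, p)\<leftarrow>ps. real d * (cmod (nat_poly p z))\<^sup>2) > 0"
        by (auto simp: a)
      moreover have "real d * (cmod (nat_poly p z))\<^sup>2 \<ge> 0" by simp
      ultimately show ?thesis
        unfolding a list.map sum_list.Cons prod.case by linarith
    qed
  qed simp
  with z have "Im z * S > 0"
    by simp
  with eq D show ?thesis
    by (metis of_nat_0_less_iff zero_less_mult_pos)
qed

text \<open>Induction on \<open>j\<close> by the Pluecker relation with \<open>f h\<close> as fourth
  vector. For six entries this reduces 15 pairs to 9.\<close>

lemma crs_chain_pos:
  assumes ref: "\<And>i. i < h \<Longrightarrow> crs (f i) (f h) > 0"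
    and adj: "\<And>i. i < h \<Longrightarrow> crs (f i) (f (Suc i)) > 0"
    and "i < j" "j \<le> h"
  shows "crs (f i) (f j) > 0"
  using \<open>i < j\<close> \<open>j \<le> h\<close>
proof (induction j)
  case (Suc j)
  show ?case
  proof (cases "Suc j = h")
    case True
    then show ?thesis using ref Suc.prems by simp
  next
    case False
    show ?thesis
    proof (cases "i = j")
      case True
      then show ?thesis using adj Suc.prems by simp
    next
    case ne: False
    with False Suc.prems have j: "i < j" "Suc j < h" by simp_all
    have "crs (f i) (f j) * crs (f (Suc j)) (f h) + crs (f i) (f h) * crs (f j) (f (Suc j)) > 0"
      using j Suc.IH ref adj by (intro add_pos_pos mult_pos_pos) simp_all
    then have "crs (f i) (f (Suc j)) * crs (f j) (f h) > 0"
      unfolding crs_plucker .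
    then show ?thesis
      using ref[of j] j by (simp add: zero_less_mult_iff)
    qed
  qed
qed simp

text \<open>The halves are glued at the repeated middle entry, and the whole turn from
  \<open>f 0\<close> to \<open>z * f 0\<close> is less than \<open>\<pi>\<close>. Pluecker relations
  carry the signs across the middle and across the wrap.\<close>

lemma ccw_of_halves:
  assumes z: "Im z > 0" and h: "h > 0"
    and low: "\<And>i j. i < j \<Longrightarrow> j \<le> h \<Longrightarrow> crs (f i) (f j) > 0"
    and high: "\<And>i j. h < i \<Longrightarrow> i < j \<Longrightarrow> j \<le> 2 * h + 1 \<Longrightarrow> crs (f i) (f j) > 0"
    and mid: "f (Suc h) = f h" and wrap: "f (2 * h + 1) = z * f 0"
  shows "ccw (2 * h + 2) z f"
proof -
  let ?l = "2 * h + 1"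
  have "f 0 \<noteq> 0"
    using low[of 0 h] h by auto
  then have first_last: "crs (f 0) (f ?l) > 0"
    using z unfolding wrap crs_mult_self by simp
  have mid_high: "crs (f h) (f j) \<ge> 0" if "h < j" "j \<le> ?l" for j
    using that high[of "Suc h" j] mid by (cases "j = Suc h") (simp_all add: less_imp_le)
  have mid_last: "crs (f h) (f ?l) > 0"
    using high[of "Suc h" ?l] h mid by simp
  have first: "crs (f 0) (f j) > 0" if j: "h < j" "j \<le> ?l" for j
  proof (cases "j = ?l")
    case False
    have "crs (f 0) (f h) * crs (f j) (f ?l) + crs (f 0) (f ?l) * crs (f h) (f j) > 0"
      using j False h first_last low high mid_high by (intro add_pos_nonneg mult_pos_pos mult_nonneg_nonneg) (simp_all add: less_imp_le)
    then have "crs (f 0) (f j) * crs (f h) (f ?l) > 0"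
      unfolding crs_plucker .
    then show ?thesis
      using mid_last by (simp add: zero_less_mult_iff)
  qed (use first_last in simp)
  have cross: "crs (f i) (f j) > 0" if i: "i < h" and j: "h < j" "j \<le> ?l" for i j
  proof (cases "i = 0")
    case False
    have "crs (f 0) (f i) * crs (f h) (f j) + crs (f 0) (f j) * crs (f i) (f h) > 0"
      using i j False low[of 0 i] low[of i h] first[of j] mid_high[of j]
      by (intro add_nonneg_pos mult_pos_pos mult_nonneg_nonneg) simp_all
    also have "\<dots> = crs (f 0) (f h) * crs (f i) (f j)"
      using crs_plucker[of "f 0" "f i" "f h" "f j"] crs_plucker[of "f 0" "f i" "f j" "f h"]
      by (simp add: crs_def algebra_simps)
    finally show ?thesis
      using low[of 0 h] h by (simp add: zero_less_mult_iff)
  qed (use first j in simp)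
  have nonneg: "crs (f i) (f j) \<ge> 0" if "i \<le> j" "j \<le> ?l" for i j
  proof -
    have "crs (f i) (f j) \<ge> 0" if "i < j"
    proof (cases "j \<le> h")
      case True
      with low[OF \<open>i < j\<close>] show ?thesis by simp
    next
      case False
      show ?thesis
      proof (cases i h rule: linorder_cases)
        case less
        with cross[of i j] False \<open>j \<le> ?l\<close> show ?thesis by simp
      next
        case equal
        with mid_high[of j] False \<open>j \<le> ?l\<close> show ?thesis by simp
      next
        case greater
        with high[of i j] \<open>i < j\<close> \<open>j \<le> ?l\<close> show ?thesis by simp
      qed
    qed
    then show ?thesis
      using that(1) by (cases "i = j") simp_all
  qed
  have last: "crs (f i) (f ?l) > 0" if "i < ?l" for i
  proof (cases i h rule: linorder_cases)
    case less
    with cross[of i ?l] show ?thesis by simp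
  next
    case equal
    with mid_last show ?thesis by simp
  next
    case greater
    with high[of i ?l] that show ?thesis by simp
  qed
  have rot: "crs (f j) (z * f i) \<ge> 0" if "i \<le> j" "j \<le> ?l" for i j
  proof (cases "i = ?l")
    case True
    then have "j = i" using that by simp
    then show ?thesis
      using z unfolding \<open>j = i\<close> crs_mult_self by simp
  next
    case False
    then have "i < ?l" using that by simp
    have "crs (f ?l) (z * f i) \<ge> 0"
      unfolding wrap crs_mult_mult using nonneg[of 0 i] that by simp
    moreover have "crs (f i) (z * f i) \<ge> 0"
      using z unfolding crs_mult_self by simp
    ultimately have "crs (f i) (f j) * crs (f ?l) (z * f i) + crs (f i) (z * f i) * crs (f j) (f ?l) \<ge> 0"
      using that nonneg by simp
    then have "crs (f i) (f ?l) * crs (f j) (z * f i) \<ge> 0"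
      unfolding crs_plucker .
    then show ?thesis
      using last[OF \<open>i < ?l\<close>] by (simp add: zero_le_mult_iff)
  qed
  have "0 < crs (f 0) (f ?l)" by (rule first_last)
  also have "\<dots> \<le> (\<Sum>j<2*h+2. crs (f 0) (f j))"
    by (rule member_le_sum) (use nonneg in auto)
  also have "\<dots> = crs (f 0) (\<Sum>j<2*h+2. f j)"
    using crs_sum_sum[of "\<lambda>_. f 0" "{0::nat}" f "{..<2*h+2}"] by simp
  finally have "(\<Sum>j<2*h+2. f j) \<noteq> 0"
    by auto
  with nonneg rot show ?thesis
    by (simp add: ccw_def)
qed

section \<open>Explicit sequences at levels 3 to 6\<close>

definition aff_coeffs3 :: "nat list list" where
  "aff_coeffs3 =
    [[1, 0, 1],
     [0, 2],
     [0, 2],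
     [0, 0, 2],
     [0, 0, 2],
     [0, 1, 0, 1]]"

definition aff_coeffs4 :: "nat list list" where
  "aff_coeffs4 =
    [[1, 5, 5, 1],
     [0, 6, 4, 2],
     [0, 4, 6, 2],
     [0, 2, 8, 2],
     [0, 2, 8, 2],
     [0, 2, 6, 4],
     [0, 2, 4, 6],
     [0, 1, 5, 5, 1]]"

definition aff_coeffs5 :: "nat list list" where
  "aff_coeffs5 =
    [[1, 24, 46, 24, 1],
     [0, 20, 46, 28, 2],
     [0, 14, 48, 30, 4],
     [0, 10, 46, 34, 6],
     [0, 8, 40, 40, 8],
     [0, 8, 40, 40, 8],
     [0, 6, 34, 46, 10],
     [0, 4, 30, 48, 14],
     [0, 2, 28, 46, 20],
     [0, 1, 24, 46, 24, 1]]"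

text \<open>Zeros pad all rows to seven coefficients, so that row \<open>11 - i\<close> is exactly
  row \<open>i\<close> reversed.\<close>

definition aff_coeffs6 :: "nat list list" where
  "aff_coeffs6 =
    [[1, 97, 382, 382, 97, 1, 0],
     [0, 74, 360, 404, 120, 2, 0],
     [0, 54, 334, 422, 146, 4, 0],
     [0, 40, 300, 440, 172, 8, 0],
     [0, 30, 264, 452, 200, 14, 0],
     [0, 22, 232, 452, 232, 22, 0],
     [0, 22, 232, 452, 232, 22, 0],
     [0, 14, 200, 452, 264, 30, 0],
     [0, 8, 172, 440, 300, 40, 0],
     [0, 4, 146, 422, 334, 54, 0],
     [0, 2, 120, 404, 360, 74, 0],
     [0, 1, 97, 382, 382, 97, 1]]"

lemma All_less_iff_list_all: "(\<forall>i<n. P i) \<longleftrightarrow> list_all P [0..<n]"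
  by (auto simp: list_all_iff)

lemma All_less_6: "(\<forall>i<6. P i) \<longleftrightarrow> P (0 :: nat) \<and> P (Suc 0) \<and> P 2 \<and> P 3 \<and> P 4 \<and> P 5"
  unfolding All_less_iff_list_all by (simp add: upt_rec numeral_eq_Suc)

lemma All_less_8: "(\<forall>i<8. P i) \<longleftrightarrow> P (0 :: nat) \<and> P (Suc 0) \<and> P 2 \<and> P 3 \<and> P 4 \<and> P 5 \<and> P 6 \<and> P 7"
  unfolding All_less_iff_list_all by (simp add: upt_rec numeral_eq_Suc)

lemma All_less_10: "(\<forall>i<10. P i) \<longleftrightarrow> P (0 :: nat) \<and> P (Suc 0) \<and> P 2 \<and> P 3 \<and> P 4 \<and> P 5 \<and> P 6 \<and> P 7 \<and> P 8 \<and> P 9"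
  unfolding All_less_iff_list_all by (simp add: upt_rec numeral_eq_Suc)

lemma All_less_12: "(\<forall>i<12. P i) \<longleftrightarrow> P (0 :: nat) \<and> P (Suc 0) \<and> P 2 \<and> P 3 \<and> P 4 \<and> P 5 \<and> P 6 \<and> P 7 \<and> P 8 \<and> P 9 \<and> P 10 \<and> P 11"
  unfolding All_less_iff_list_all by (simp add: upt_rec numeral_eq_Suc)

text \<open>The else branch is trivial: the bound on the cut is then decided by evaluation once
  \<open>i\<close> is a numeral.\<close>

lemma step_nth:
  assumes "\<forall>i<2 * m. f i = xs ! i" "length xs = 2 * m"
  shows "step m z f i = (let c = (if i \<le> m then i else i - 1) in
    if c \<le> 2 * m then z * sum_list (take c xs) + sum_list (drop c xs) else step m z f i)"
proof -
  define c where "c = (if i \<le> m then i else i - 1)"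
  have "step m z f i = z * sum_list (take c xs) + sum_list (drop c xs)" if c: "c \<le> 2 * m"
  proof -
    have "(\<Sum>j<c. f j) = sum_list (take c xs)"
      using assms c by (auto simp: sum_list_sum_nth atLeast0LessThan intro!: sum.cong)
    moreover have "(\<Sum>j=c..<2 * m. f j) = sum_list (drop c xs)"
      using assms c sum.shift_bounds_nat_ivl[of f 0 c "2 * m - c"]
      by (simp add: sum_list_sum_nth add.commute)
    ultimately show ?thesis
      by (simp add: step_def c_def Let_def)
  qed
  then show ?thesis
    by (simp add: c_def Let_def)
qed

lemma aff_seq_0: "\<forall>i<6. aff_seq z 0 i = nat_poly (aff_coeffs3 ! i) z"
  unfolding All_less_6
  by (simp add: aff_seq_def aff_coeffs3_def step_def shift_def numeral_eq_Suc algebra_simps)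

lemma aff_seq_1: "\<forall>i<8. aff_seq z (Suc 0) i = nat_poly (aff_coeffs4 ! i) z"
proof -
  have "\<forall>i<2 * 3. aff_seq z 0 i = map (\<lambda>cs. nat_poly cs z) aff_coeffs3 ! i"
    using aff_seq_0[of z] by (simp add: All_less_6 aff_coeffs3_def)
  note S = step_nth[OF this, of z]
  show ?thesis
    unfolding All_less_8
    using aff_seq_Suc[of _ 0 z] by (simp add: S aff_coeffs3_def aff_coeffs4_def algebra_simps)
qed

lemma aff_seq_2: "\<forall>i<10. aff_seq z 2 i = nat_poly (aff_coeffs5 ! i) z"
proof -
  have "\<forall>i<2 * 4. aff_seq z (Suc 0) i = map (\<lambda>cs. nat_poly cs z) aff_coeffs4 ! i"
    using aff_seq_1[of z] by (simp add: All_less_8 aff_coeffs4_def)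
  note S = step_nth[OF this, of z]
  show ?thesis
    unfolding All_less_10
    using aff_seq_Suc[of _ "Suc 0" z] by (simp add: S aff_coeffs4_def aff_coeffs5_def numeral_2_eq_2[symmetric] algebra_simps)
qed

lemma aff_seq_3: "\<forall>i<12. aff_seq z 3 i = nat_poly (aff_coeffs6 ! i) z"
proof -
  have "\<forall>i<2 * 5. aff_seq z 2 i = map (\<lambda>cs. nat_poly cs z) aff_coeffs5 ! i"
    using aff_seq_2[of z] by (simp add: All_less_10 aff_coeffs5_def)
  note S = step_nth[OF this, of z]
  show ?thesis
    unfolding All_less_12
    using aff_seq_Suc[of _ 2 z] by (simp add: S aff_coeffs5_def aff_coeffs6_def numeral_3_eq_3[symmetric] algebra_simps)
qed

text \<open>
  The numbers below come from diagonalizing the Bezout matrices of the pairs over the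
  rationals.
\<close>

lemma crs_aff_coeffs6_0_1:
  assumes z: "Im z > 0"
  shows "crs (nat_poly (aff_coeffs6 ! 0) z) (nat_poly (aff_coeffs6 ! 1) z) > 0"
proof -
  \<comment> \<open>Strictness comes from the last polynomial of the certificate, here
    \<open>z ^ 3 * (1 + z)\<close>; in each later certificate it is likewise a power of
    \<open>z\<close>, possibly times \<open>1 + z\<close>.\<close>
  have "z \<noteq> 0" "1 + z \<noteq> 0"
    using z by (auto simp: complex_eq_iff)
  then show ?thesis
    by (intro crs_pos_of_bezout[where D = 271772659 and ps =
      "[(14690414, [37, 180, 202, 60, 1]),
        (86224, [0, 4089, 6995, 2991, 85]),
        (33152, [0, 0, 5389, 5700, 311]),
        (16267023360, [0, 0, 0, 1, 1])]"])
      (simp_all add: z aff_coeffs6_def, simp add: algebra_simps)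
qed

lemma crs_aff_coeffs6_1_2:
  assumes z: "Im z > 0"
  shows "crs (nat_poly (aff_coeffs6 ! 1) z) (nat_poly (aff_coeffs6 ! 2) z) > 0"
proof -
  have "z \<noteq> 0" "1 + z \<noteq> 0"
    using z by (auto simp: complex_eq_iff)
  then show ?thesis
    by (intro crs_pos_of_bezout[where D = 136817 and ps =
      "[(11644, [0, 47, 193, 193, 47]),
        (96, [0, 1739, 4650, 2911]),
        (405809280, [0, 1, 1])]"])
      (simp_all add: z aff_coeffs6_def, simp add: algebra_simps)
qed

lemma crs_aff_coeffs6_2_3:
  assumes z: "Im z > 0"
  shows "crs (nat_poly (aff_coeffs6 ! 2) z) (nat_poly (aff_coeffs6 ! 3) z) > 0"
proof -
  have "z \<noteq> 0" "1 + z \<noteq> 0"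
    using z by (auto simp: complex_eq_iff)
  then show ?thesis
    by (intro crs_pos_of_bezout[where D = 76266435 and ps =
      "[(40675432, [0, 17, 92, 101, 30]),
        (79328, [0, 1187, 4202, 2051]),
        (11520, [0, 2291, 2479]),
        (32605977600, [0, 1])]"])
      (simp_all add: z aff_coeffs6_def, simp add: algebra_simps)
qed

lemma crs_aff_coeffs6_3_4:
  assumes z: "Im z > 0"
  shows "crs (nat_poly (aff_coeffs6 ! 3) z) (nat_poly (aff_coeffs6 ! 4) z) > 0"
proof -
  have "z \<noteq> 0" "1 + z \<noteq> 0"
    using z by (auto simp: complex_eq_iff)
  then show ?thesis
    by (intro crs_pos_of_bezout[where D = 690235845 and ps =
      "[(707934200, [0, 39, 122, 71, 8]),
        (202888, [0, 0, 4885, 4198, 757]),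
        (104832, [0, 0, 0, 3623, 1867]),
        (30726259200, [0, 0, 0, 0, 1])]"])
      (simp_all add: z aff_coeffs6_def, simp add: algebra_simps)
qed

lemma crs_aff_coeffs6_4_5:
  assumes z: "Im z > 0"
  shows "crs (nat_poly (aff_coeffs6 ! 4) z) (nat_poly (aff_coeffs6 ! 5) z) > 0"
proof -
  have "z \<noteq> 0" "1 + z \<noteq> 0"
    using z by (auto simp: complex_eq_iff)
  then show ?thesis
    by (intro crs_pos_of_bezout[where D = 12006423 and ps =
      "[(10672376, [0, 36, 113, 80, 11]),
        (1672, [0, 0, 6383, 8060, 1637]),
        (628992, [0, 0, 0, 209, 91]),
        (2850785280, [0, 0, 0, 0, 1])]"])
      (simp_all add: z aff_coeffs6_def, simp add: algebra_simps)
qed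

lemma crs_aff_coeffs6_0_5:
  assumes z: "Im z > 0"
  shows "crs (nat_poly (aff_coeffs6 ! 0) z) (nat_poly (aff_coeffs6 ! 5) z) > 0"
proof -
  have "z \<noteq> 0" "1 + z \<noteq> 0"
    using z by (auto simp: complex_eq_iff)
  then show ?thesis
    by (intro crs_pos_of_bezout[where D = 48995767887781 and ps =
      "[(8908321434142, [11, 116, 226, 116, 11]),
        (53519503960, [0, 3329, 8499, 4935, 517]),
        (6967840, [0, 0, 337961, 367238, 60761]),
        (14764780800, [0, 0, 0, 3959, 1475]),
        (19959680335795200, [0, 0, 0, 0, 1])]"])
      (simp_all add: z aff_coeffs6_def, simp add: algebra_simps)
qed

lemma crs_aff_coeffs6_1_5:
  assumes z: "Im z > 0"
  shows "crs (nat_poly (aff_coeffs6 ! 1) z) (nat_poly (aff_coeffs6 ! 5) z) > 0"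
proof -
  have "z \<noteq> 0" "1 + z \<noteq> 0"
    using z by (auto simp: complex_eq_iff)
  then show ?thesis
    by (intro crs_pos_of_bezout[where D = 908655855871 and ps =
      "[(106900688926, [0, 99, 466, 499, 136]),
        (712562, [0, 74087, 254210, 150023]),
        (13056, [0, 426163, 712562]),
        (1073181681296640, [0, 1])]"])
      (simp_all add: z aff_coeffs6_def, simp add: algebra_simps)
qed

lemma crs_aff_coeffs6_2_5:
  assumes z: "Im z > 0"
  shows "crs (nat_poly (aff_coeffs6 ! 2) z) (nat_poly (aff_coeffs6 ! 5) z) > 0"
proof -
  have "z \<noteq> 0" "1 + z \<noteq> 0"
    using z by (auto simp: complex_eq_iff)
  then show ?thesis
    by (intro crs_pos_of_bezout[where D = 197838628089179 and ps =
      "[(1385909828996, [0, 275, 1605, 1869, 571]),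
        (11206448, [0, 203971, 845866, 494683]),
        (1534848, [0, 415747, 700403]),
        (188468033616760320, [0, 1])]"])
      (simp_all add: z aff_coeffs6_def, simp add: algebra_simps)
qed

lemma crs_aff_coeffs6_3_5:
  assumes z: "Im z > 0"
  shows "crs (nat_poly (aff_coeffs6 ! 3) z) (nat_poly (aff_coeffs6 ! 5) z) > 0"
proof -
  have "z \<noteq> 0" "1 + z \<noteq> 0"
    using z by (auto simp: complex_eq_iff)
  then show ?thesis
    by (intro crs_pos_of_bezout[where D = 246294017035 and ps =
      "[(5881648168, [0, 335, 1050, 687, 88]),
        (276760, [0, 0, 106259, 110330, 21251]),
        (21251328, [0, 0, 0, 6919, 3326]),
        (69233125651200, [0, 0, 0, 0, 1])]"])
      (simp_all add: z aff_coeffs6_def, simp add: algebra_simps)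
qed

lemma aff_coeffs6_low:
  assumes z: "Im z > 0" and "i < j" "j \<le> 5"
  shows "crs (nat_poly (aff_coeffs6 ! i) z) (nat_poly (aff_coeffs6 ! j) z) > 0"
proof (rule crs_chain_pos[OF _ _ assms(2,3), of "\<lambda>i. nat_poly (aff_coeffs6 ! i) z"])
  fix i :: nat assume "i < 5"
  then have i: "i \<in> {0, 1, 2, 3, 4}" by auto
  then show "crs (nat_poly (aff_coeffs6 ! i) z) (nat_poly (aff_coeffs6 ! 5) z) > 0"
    using crs_aff_coeffs6_0_5[OF z] crs_aff_coeffs6_1_5[OF z] crs_aff_coeffs6_2_5[OF z] crs_aff_coeffs6_3_5[OF z] crs_aff_coeffs6_4_5[OF z]
    by auto
  show "crs (nat_poly (aff_coeffs6 ! i) z) (nat_poly (aff_coeffs6 ! Suc i) z) > 0"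
    using i crs_aff_coeffs6_0_1[OF z] crs_aff_coeffs6_1_2[OF z] crs_aff_coeffs6_2_3[OF z] crs_aff_coeffs6_3_4[OF z] crs_aff_coeffs6_4_5[OF z]
    by (auto simp flip: numeral_2_eq_2)
qed

lemma aff_coeffs6_rev:
  assumes "z \<noteq> 0" "i < 12"
  shows "nat_poly (aff_coeffs6 ! i) z = z ^ 6 * nat_poly (aff_coeffs6 ! (11 - i)) (inverse z)"
proof -
  have "\<forall>i<12. aff_coeffs6 ! i = rev (aff_coeffs6 ! (11 - i)) \<and> length (aff_coeffs6 ! (11 - i)) = 7"
    unfolding All_less_12 by (simp add: aff_coeffs6_def)
  then have eq: "aff_coeffs6 ! i = rev (aff_coeffs6 ! (11 - i))" and len: "length (aff_coeffs6 ! (11 - i)) = 7"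
    using assms(2) by blast+
  have "aff_coeffs6 ! (11 - i) \<noteq> []"
    using len by (metis list.size(3) zero_neq_numeral)
  then have "nat_poly (rev (aff_coeffs6 ! (11 - i))) z = z ^ (7 - 1) * nat_poly (aff_coeffs6 ! (11 - i)) (inverse z)"
    unfolding len[symmetric] by (rule nat_poly_rev[OF assms(1)])
  then show ?thesis
    by (simp only: eq[symmetric]) simp
qed

text \<open>The point \<open>w = cnj (inverse z)\<close> lies in the upper half-plane too. Passing
  to \<open>w\<close> reverses the order of the rows and conjugates the values; both reverse the
  orientation, so the upper half follows from the lower one.\<close>

lemma aff_coeffs6_high:
  assumes z: "Im z > 0" and ij: "5 < i" "i < j" "j \<le> 11"
  shows "crs (nat_poly (aff_coeffs6 ! i) z) (nat_poly (aff_coeffs6 ! j) z) > 0"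
proof -
  define w where "w = cnj (inverse z)"
  have z0: "z \<noteq> 0"
    using z by auto
  have "(Re z)\<^sup>2 + (Im z)\<^sup>2 > 0"
    using z by (simp add: sum_power2_gt_zero_iff)
  with z have "Im w > 0"
    by (simp add: w_def)
  then have *: "crs (nat_poly (aff_coeffs6 ! (11 - j)) w) (nat_poly (aff_coeffs6 ! (11 - i)) w) > 0"
    using ij by (intro aff_coeffs6_low) auto
  have eq: "nat_poly (aff_coeffs6 ! k) z = z ^ 6 * cnj (nat_poly (aff_coeffs6 ! (11 - k)) w)" if "k < 12" for k
    using aff_coeffs6_rev[OF z0 that] by (simp add: cnj_nat_poly w_def)
  have "crs (nat_poly (aff_coeffs6 ! i) z) (nat_poly (aff_coeffs6 ! j) z) =
      (cmod (z ^ 6))\<^sup>2 * crs (nat_poly (aff_coeffs6 ! (11 - j)) w) (nat_poly (aff_coeffs6 ! (11 - i)) w)"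
    using ij by (simp add: eq crs_mult_mult) (simp add: crs_def)
  then show ?thesis
    using * z0 by simp
qed

lemma ccw_aff_coeffs6:
  assumes z: "Im z > 0"
  shows "ccw 12 z (\<lambda>i. nat_poly (aff_coeffs6 ! i) z)"
proof -
  have "ccw (2 * 5 + 2) z (\<lambda>i. nat_poly (aff_coeffs6 ! i) z)"
  proof (rule ccw_of_halves[OF z])
    show "crs (nat_poly (aff_coeffs6 ! i) z) (nat_poly (aff_coeffs6 ! j) z) > 0" if "i < j" "j \<le> 5" for i j
      by (rule aff_coeffs6_low[OF z that])
    show "crs (nat_poly (aff_coeffs6 ! i) z) (nat_poly (aff_coeffs6 ! j) z) > 0" if "5 < i" "i < j" "j \<le> 2 * 5 + 1" for i j
      using aff_coeffs6_high[OF z that(1,2)] that(3) by simp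
  qed (simp_all add: aff_coeffs6_def)
  then show ?thesis by simp
qed

section \<open>Nonvanishing in the upper half-plane and real zeros\<close>

lemma ccw_cong: "(\<And>i. i < N \<Longrightarrow> f i = g i) \<Longrightarrow> ccw N z f = ccw N z g"
  by (auto simp: ccw_def)

lemma ccw_aff_seq:
  assumes z: "Im z > 0"
  shows "ccw (2 * (k + 6)) z (aff_seq z (k + 3))"
proof (induction k)
  case 0
  show ?case
    using ccw_aff_coeffs6[OF z] ccw_cong[of 12 "aff_seq z 3" "\<lambda>i. nat_poly (aff_coeffs6 ! i) z" z] aff_seq_3[of z]
    by simp
next
  case (Suc k)
  have "ccw (2 * (k + 6) + 2) z (step (k + 6) z (aff_seq z (k + 3)))"
    by (rule ccw_step[OF z Suc.IH])
  moreover have "aff_seq z (Suc (k + 3)) i = step (k + 6) z (aff_seq z (k + 3)) i" if "i < 2 * (k + 6) + 2" for i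
    using aff_seq_Suc[of i "k + 3" z] that by (simp add: add.assoc)
  ultimately show ?case
    using ccw_cong[of "2 * (k + 6) + 2" "aff_seq z (Suc (k + 3))"] by simp
qed

lemma aff_seq_middle_nonzero:
  assumes z: "Im z > 0"
  shows "aff_seq z (Suc k) (k + 3) \<noteq> 0"
proof -
  have z0: "z \<noteq> 0" "1 + z \<noteq> 0"
    using z by (auto simp: complex_eq_iff)
  \<comment> \<open>The zeros of this factor are the real numbers \<open>-2 + sqrt 3\<close> and
    \<open>-2 - sqrt 3\<close>.\<close>
  have quad: "1 + 4 * z + z\<^sup>2 \<noteq> 0"
  proof
    assume "1 + 4 * z + z\<^sup>2 = 0"
    then have re: "1 + 4 * Re z + (Re z)\<^sup>2 - (Im z)\<^sup>2 = 0" and im: "(4 + 2 * Re z) * Im z = 0"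
      by (simp_all add: complex_eq_iff power2_eq_square algebra_simps)
    from im z have "Re z = -2" by simp
    with re have "(Im z)\<^sup>2 = -3" by simp
    then show False
      using zero_le_power2[of "Im z"] by linarith
  qed
  \<comment> \<open>The entry for \<open>k\<close> has level \<open>k + 4\<close>, and
    \<open>ccw_step_nonzero\<close> needs turning one level lower, which is available from level 6.
    So \<open>k < 3\<close> is read off the tables.\<close>
  have "k = 0 \<or> k = 1 \<or> k = 2 \<or> k = (k - 3) + 3"
    by arith
  then consider "k = 0" | "k = 1" | "k = 2" | l where "k = l + 3"
    by blast
  then show ?thesis
  proof cases
    case 1
    have "aff_seq z (Suc 0) 3 = 2 * z * (1 + 4 * z + z\<^sup>2)"
      using aff_seq_1[of z] by (simp add: aff_coeffs4_def algebra_simps power2_eq_square)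
    then show ?thesis
      using 1 z0 quad by simp
  next
    case 2
    have "aff_seq z 2 4 = 8 * z * (1 + z) * (1 + 4 * z + z\<^sup>2)"
      using aff_seq_2[of z] by (simp add: aff_coeffs5_def algebra_simps power2_eq_square)
    then show ?thesis
      using 2 z0 quad by (simp flip: numeral_2_eq_2)
  next
    case 3
    have "aff_seq z 3 5 \<noteq> 0"
      using aff_seq_3[of z] crs_aff_coeffs6_0_5[OF z] by auto
    then show ?thesis
      using 3 by simp
  next
    case 4
    have "step (l + 6) z (aff_seq z (l + 3)) (l + 6) \<noteq> 0"
      by (rule ccw_step_nonzero[OF z ccw_aff_seq[OF z]]) simp
    then show ?thesis
      using aff_seq_Suc[of "l + 6" "l + 3" z] 4 by (simp add: add.assoc)
  qed
qed

lemma poly_affine_Eulerian_D: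
  "poly (map_poly complex_of_real (affine_Eulerian_D n)) z = (\<Sum>\<sigma>\<in>weyl_D n. z ^ card (affine_Des_D n \<sigma>))"
proof -
  have "map_poly complex_of_real (affine_Eulerian_D n) = (\<Sum>\<sigma>\<in>weyl_D n. monom 1 (card (affine_Des_D n \<sigma>)))"
    unfolding affine_Eulerian_D_def by (intro poly_eqI) (simp add: coeff_map_poly coeff_sum if_distrib cong: if_cong)
  then show ?thesis
    by (simp add: poly_sum poly_monom)
qed

theorem theorem4p5:
  fixes n :: nat and z :: complex
  assumes "n \<ge> 3"
    and "poly (map_poly complex_of_real (affine_Eulerian_D n)) z = 0"
  shows "z \<in> \<real>"
proof -
  obtain k where n: "n = k + 3"
    using assms(1) by (metis add.commute le_Suc_ex)
  let ?S = "\<lambda>z :: complex. \<Sum>\<sigma>\<in>weyl_D n. z ^ card (affine_Des_D n \<sigma>)"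
  have upper: "?S w \<noteq> 0" if "Im w > 0" for w
    unfolding n sum_weyl_D_aff_seq using aff_seq_middle_nonzero[OF that] by simp
  have "?S z = 0"
    using assms(2) by (simp add: poly_affine_Eulerian_D)
  \<comment> \<open>Real coefficients transfer nonvanishing to the lower half-plane.\<close>
  moreover have "?S (cnj z) = cnj (?S z)"
    by simp
  ultimately have "\<not> Im z > 0" "\<not> Im (cnj z) > 0"
    using upper by (metis complex_cnj_zero)+
  then show ?thesis
    by (simp add: complex_is_Real_iff)
qed

end
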